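(* Let the variables be partitioned as $\mathbf{x}=(x_1,\ldots,x_d)$, $\mathbf{y}=(y_1,\ldots,y_u)$, $\mathbf{z}=(z_1,\ldots,z_v)$. Let $\phi=f_1\ge0\wedge\cdots\wedge f_{r_1}\ge0\wedge g_1>0\wedge\cdots\wedge g_{s_1}>0$ with $f_1,\ldots,f_{r_1},g_1,\ldots,g_{s_1}\in\mathbb{R}[\mathbf{x},\mathbf{y}]$, and $\psi=f_{r_1+1}\ge0\wedge\cdots\wedge f_r\ge0\wedge g_{s_1+1}>0\wedge\cdots\wedge g_s>0$ with $f_{r_1+1},\ldots,f_r,g_{s_1+1},\ldots,g_s\in\mathbb{R}[\mathbf{x},\mathbf{z}]$, where all $f_i,g_j$ are concave quadratic and $\phi\wedge\psi$ has no real solution. Suppose there do not exist $\delta_1,\ldots,\delta_r\ge0$ such that $-(\delta_1f_1+\cdots+\delta_rf_r)$ is a nonzero sum of squares. Then there exist $\lambda_1,\ldots,\lambda_r\ge0$, $\eta_0,\ldots,\eta_s\ge0$ and sum-of-squares polynomials $h_1\in\mathbb{R}[\mathbf{x},\mathbf{y}]$, $h_2\in\mathbb{R}[\mathbf{x},\mathbf{z}]$ of degree at most $2$ such that $$\sum_{i=1}^r\lambda_if_i+\sum_{j=1}^s\eta_jg_j+\eta_0+h_1+h_2\equiv0,\qquad \eta_0+\eta_1+\cdots+\eta_s=1.$$ Moreover, for such data let $I=\sum_{i=1}^{r_1}\lambda_if_i+\sum_{j=1}^{s_1}\eta_jg_j+\eta_0+h_1$. Then $I\in\mathbb{R}[\mathbf{x}]$,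 and if $\sum_{j=0}^{s_1}\eta_j>0$ then $I>0$ is an interpolant for $\phi$ and $\psi$; otherwise $I\ge0$ is an interpolant for $\phi$ and $\psi$.
   Context: A polynomial is concave quadratic if it has the form $\mathbf{w}^TA\mathbf{w}+2\vec\alpha^T\mathbf{w}+a$ (in all its variables $\mathbf{w}$) with $A$ real symmetric negative semidefinite. A sum of squares is a finite sum of squares of real polynomials. Given formulas $\phi,\psi$ over the reals with $\phi\wedge\psi$ unsatisfiable, a (reverse) interpolant is a formula $I$ such that $\phi\models I$, $I\wedge\psi$ is unsatisfiable, and $I$ contains only variables common to $\phi$ and $\psi$ (here, only $\mathbf{x}$). *)

theory Defs
  imports Complex_Main "HOL-Library.Poly_Mapping"
begin

datatype var = X nat | Y nat | Z nat

definition xs :: "nat \<Rightarrow> var set" where "xs d = X ` {1..d}"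
definition ys :: "nat \<Rightarrow> var set" where "ys u = Y ` {1..u}"
definition zs :: "nat \<Rightarrow> var set" where "zs v = Z ` {1..v}"

text \<open>
  Formal multivariate polynomials: finitely supported maps from monomials (exponent vectors)
  to coefficients. Ring operations are those of \<^theory>\<open>HOL-Library.Poly_Mapping\<close>, where
  multiplication is convolution.
\<close>

type_synonym monom = "var \<Rightarrow>\<^sub>0 nat"
type_synonym mpoly = "monom \<Rightarrow>\<^sub>0 real"

definition Const :: "real \<Rightarrow> mpoly" where
  "Const c = Poly_Mapping.single 0 c"

definition Var :: "var \<Rightarrow> mpoly" where
  "Var i = Poly_Mapping.single (Poly_Mapping.single i 1) 1"

definition vars :: "mpoly \<Rightarrow> var set" where
  "vars p = (\<Union>m\<in>Poly_Mapping.keys p. Poly_Mapping.keys m)"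

definition polys :: "var set \<Rightarrow> mpoly set" where
  "polys V = {p. vars p \<subseteq> V}"

definition total_degree :: "mpoly \<Rightarrow> nat" where
  "total_degree p = Max (insert 0
     ((\<lambda>m. \<Sum>i\<in>Poly_Mapping.keys m. Poly_Mapping.lookup m i) ` Poly_Mapping.keys p))"

definition eval_mpoly :: "(var \<Rightarrow> real) \<Rightarrow> mpoly \<Rightarrow> real" where
  "eval_mpoly w p = (\<Sum>m\<in>Poly_Mapping.keys p. Poly_Mapping.lookup p m *
     (\<Prod>i\<in>Poly_Mapping.keys m. w i ^ Poly_Mapping.lookup m i))"

definition sos :: "mpoly \<Rightarrow> bool" where
  "sos p \<longleftrightarrow> (\<exists>qs. p = (\<Sum>q\<leftarrow>qs. q ^ 2))"

definition neg_semidef :: "var set \<Rightarrow> (var \<Rightarrow> var \<Rightarrow> real) \<Rightarrow> bool" where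
  "neg_semidef V A \<longleftrightarrow> (\<forall>i\<in>V. \<forall>j\<in>V. A i j = A j i) \<and>
     (\<forall>w. (\<Sum>i\<in>V. \<Sum>j\<in>V. w i * A i j * w j) \<le> 0)"

definition concave_quadratic :: "var set \<Rightarrow> mpoly \<Rightarrow> bool" where
  "concave_quadratic V p \<longleftrightarrow> (\<exists>A \<alpha> a. neg_semidef V A \<and>
     p = (\<Sum>i\<in>V. \<Sum>j\<in>V. Var i * Const (A i j) * Var j) +
         2 * (\<Sum>i\<in>V. Const (\<alpha> i) * Var i) + Const a)"

text \<open>\<open>Ge0 p\<close> and \<open>Gt0 p\<close> stand for the atoms \<open>p \<ge> 0\<close> and \<open>p > 0\<close>.\<close>

datatype formula = Ge0 mpoly | Gt0 mpoly | Conj "formula list"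

fun sat :: "(var \<Rightarrow> real) \<Rightarrow> formula \<Rightarrow> bool" where
  "sat w (Ge0 p) \<longleftrightarrow> eval_mpoly w p \<ge> 0"
| "sat w (Gt0 p) \<longleftrightarrow> eval_mpoly w p > 0"
| "sat w (Conj Fs) \<longleftrightarrow> (\<forall>F\<in>set Fs. sat w F)"

fun formula_vars :: "formula \<Rightarrow> var set" where
  "formula_vars (Ge0 p) = vars p"
| "formula_vars (Gt0 p) = vars p"
| "formula_vars (Conj Fs) = (\<Union>F\<in>set Fs. formula_vars F)"

definition entails :: "formula \<Rightarrow> formula \<Rightarrow> bool" where
  "entails F G \<longleftrightarrow> (\<forall>w. sat w F \<longrightarrow> sat w G)"

definition unsat :: "formula \<Rightarrow> bool" where
  "unsat F \<longleftrightarrow> (\<nexists>w. sat w F)"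

text \<open>
  The shared variables are a parameter \<open>V\<close> (the declared block common to both sides), rather
  than \<open>formula_vars \<phi> \<inter> formula_vars \<psi>\<close>: a declared shared variable need not actually
  occur in both formulas.
\<close>

definition interpolant :: "var set \<Rightarrow> formula \<Rightarrow> formula \<Rightarrow> formula \<Rightarrow> bool" where
  "interpolant V \<phi> \<psi> I \<longleftrightarrow> entails \<phi> I \<and> unsat (Conj [I, \<psi>]) \<and> formula_vars I \<subseteq> V"

text \<open>\<open>system f g a b c e\<close> is the conjunction of \<open>f i \<ge> 0\<close> for \<open>a \<le> i \<le> b\<close> and
  \<open>g j > 0\<close> for \<open>c \<le> j \<le> e\<close>.\<close>

definition system :: "(nat \<Rightarrow> mpoly) \<Rightarrow> (nat \<Rightarrow> mpoly) \<Rightarrow> nat \<Rightarrow> nat \<Rightarrow> nat \<Rightarrow> nat \<Rightarrow> formula" where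
  "system f g a b c e =
     Conj (map (\<lambda>i. Ge0 (f i)) [a..<Suc b] @ map (\<lambda>j. Gt0 (g j)) [c..<Suc e])"

definition certificate ::
  "nat \<Rightarrow> nat \<Rightarrow> nat \<Rightarrow> nat \<Rightarrow> nat \<Rightarrow> (nat \<Rightarrow> mpoly) \<Rightarrow> (nat \<Rightarrow> mpoly) \<Rightarrow>
   (nat \<Rightarrow> real) \<Rightarrow> (nat \<Rightarrow> real) \<Rightarrow> mpoly \<Rightarrow> mpoly \<Rightarrow> bool" where
  "certificate d u v r s f g l \<eta> h1 h2 \<longleftrightarrow>
     (\<forall>i\<in>{1..r}. l i \<ge> 0) \<and> (\<forall>j\<in>{0..s}. \<eta> j \<ge> 0) \<and>
     sos h1 \<and> h1 \<in> polys (xs d \<union> ys u) \<and> total_degree h1 \<le> 2 \<and>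
     sos h2 \<and> h2 \<in> polys (xs d \<union> zs v) \<and> total_degree h2 \<le> 2 \<and>
     (\<Sum>i=1..r. Const (l i) * f i) + (\<Sum>j=1..s. Const (\<eta> j) * g j) + Const (\<eta> 0) + h1 + h2 = 0 \<and>
     (\<Sum>j=0..s. \<eta> j) = 1"

end

theory Submission
  imports Defs
begin

text \<open>
  Adding the constraint \<open>1 > 0\<close> to the strict ones accounts for \<open>\<eta>\<^sub>0\<close>. A certificate up to the
  sum-of-squares part is a separating hyperplane for a convex set of achievable constraint values.
  The absence of a nonzero sum of squares among the \<open>- \<Sum>\<delta>\<^sub>i f\<^sub>i\<close> with \<open>\<delta> \<ge> 0\<close> plays the role of Slater's
  condition: the \<open>f\<^sub>i\<close> occurring with positive weight in a combination that vanishes identically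
  are affine, so they may enter the convex set as equations, and after discarding redundant ones among them
  the hyperplane cannot be supported on the \<open>f\<^sub>i\<close> alone.

  The resulting combination is everywhere nonpositive and is a sum of a concave quadratic in
  \<open>x, y\<close> and one in \<open>x, z\<close>. Completing squares in \<open>y\<close> only changes the first summand, completing
  squares in \<open>z\<close> only the second, and what is left involves only \<open>x\<close>.
\<close>

section \<open>Evaluation, variables and degree\<close>

text \<open>The monomial factor of \<open>eval_mpoly\<close>, named separately so that
  multiplicativity of evaluation can be reduced to monomials.\<close>

definition eval_monom :: "(var \<Rightarrow> real) \<Rightarrow> monom \<Rightarrow> real" where
  "eval_monom w m = (\<Prod>i\<in>Poly_Mapping.keys m. w i ^ Poly_Mapping.lookup m i)"

text \<open>Indices outside the support have exponent 0 and contribute a factor 1. This lets two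
  monomials and their product be evaluated over one common index set.\<close>

lemma eval_monom_superset:
  assumes "finite K" "Poly_Mapping.keys m \<subseteq> K"
  shows "eval_monom w m = (\<Prod>i\<in>K. w i ^ Poly_Mapping.lookup m i)"
  unfolding eval_monom_def
  by (rule prod.mono_neutral_left) (use assms in \<open>auto simp: in_keys_iff\<close>)

lemma eval_monom_add: "eval_monom w (m + n) = eval_monom w m * eval_monom w n"
proof -
  let ?K = "Poly_Mapping.keys m \<union> Poly_Mapping.keys n"
  have "eval_monom w (m + n) = (\<Prod>i\<in>?K. w i ^ Poly_Mapping.lookup (m + n) i)"
    by (rule eval_monom_superset) (simp_all add: Poly_Mapping.keys_add)
  also have "\<dots> = (\<Prod>i\<in>?K. w i ^ Poly_Mapping.lookup m i) * (\<Prod>i\<in>?K. w i ^ Poly_Mapping.lookup n i)"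
    by (simp add: lookup_add power_add prod.distrib)
  also have "\<dots> = eval_monom w m * eval_monom w n"
    by (simp add: eval_monom_superset[of ?K])
  finally show ?thesis .
qed

lemma eval_mpoly_alt:
  "eval_mpoly w p = (\<Sum>m\<in>Poly_Mapping.keys p. Poly_Mapping.lookup p m * eval_monom w m)"
  by (simp add: eval_mpoly_def eval_monom_def)

lemma eval_mpoly_add [simp]: "eval_mpoly w (p + q) = eval_mpoly w p + eval_mpoly w q"
  unfolding eval_mpoly_alt
  by (rule setsum_keys_plus_distrib) (auto simp: algebra_simps)

lemma eval_mpoly_0 [simp]: "eval_mpoly w 0 = 0"
  by (simp add: eval_mpoly_def)

lemma eval_mpoly_sum [simp]: "eval_mpoly w (\<Sum>i\<in>S. p i) = (\<Sum>i\<in>S. eval_mpoly w (p i))"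
  by (induction S rule: infinite_finite_induct) auto

lemma eval_mpoly_single: "eval_mpoly w (Poly_Mapping.single m c) = c * eval_monom w m"
  by (simp add: eval_mpoly_alt)

lemma mpoly_eq_sum_single:
  "p = (\<Sum>m\<in>Poly_Mapping.keys p. Poly_Mapping.single m (Poly_Mapping.lookup p m))" for p :: mpoly
  by (rule poly_mapping_eqI) (auto simp: lookup_sum lookup_single when_def in_keys_iff)

text \<open>Both factors are expanded into single monomials, where convolution is addition of
  exponents and \<open>eval_monom_add\<close> applies.\<close>

lemma eval_mpoly_mult [simp]: "eval_mpoly w (p * q) = eval_mpoly w p * eval_mpoly w q"
proof -
  let ?s = "\<lambda>p m. Poly_Mapping.single m (Poly_Mapping.lookup p m)"
  have "p * q = (\<Sum>m\<in>Poly_Mapping.keys p. ?s p m) * (\<Sum>n\<in>Poly_Mapping.keys q. ?s q n)"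
    by (simp flip: mpoly_eq_sum_single)
  also have "eval_mpoly w \<dots> = eval_mpoly w p * eval_mpoly w q"
    by (simp add: sum_product mult_single eval_mpoly_single eval_monom_add eval_mpoly_alt[of w p]
        eval_mpoly_alt[of w q] mult_ac)
  finally show ?thesis .
qed

lemma eval_mpoly_Const [simp]: "eval_mpoly w (Const c) = c"
  by (simp add: Const_def eval_mpoly_single eval_monom_def)

lemma eval_mpoly_Var [simp]: "eval_mpoly w (Var i) = w i"
  by (simp add: Var_def eval_mpoly_single eval_monom_def)

lemma Const_0 [simp]: "Const 0 = 0"
  by (simp add: Const_def)

lemma Const_1 [simp]: "Const 1 = 1"
  by (simp add: Const_def)

lemma Const_add: "Const (a + b) = Const a + Const b"
  by (simp add: Const_def single_add)

lemma Const_uminus: "Const (- a) = - Const a"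
  by (simp add: Const_def single_uminus)

lemma Const_mult: "Const (a * b) = Const a * Const b"
  by (simp add: Const_def mult_single)

lemma two_eq_Const: "2 = Const 2"
  using Const_add[of 1 1] by simp

lemma eval_mpoly_2 [simp]: "eval_mpoly w 2 = 2"
  by (simp add: two_eq_Const)

lemma eval_mpoly_uminus [simp]: "eval_mpoly w (- p) = - eval_mpoly w p"
  using eval_mpoly_add[of w p "- p"] by simp

lemma eval_mpoly_diff [simp]: "eval_mpoly w (p - q) = eval_mpoly w p - eval_mpoly w q"
  using eval_mpoly_add[of w "p - q" q] by simp

lemma eval_mpoly_cong:
  assumes "\<And>i. i \<in> vars p \<Longrightarrow> w i = w' i"
  shows "eval_mpoly w p = eval_mpoly w' p"
  unfolding eval_mpoly_def
  by (intro sum.cong refl arg_cong2[where f = "(*)"] prod.cong arg_cong2[where f = "(^)"])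
     (use assms in \<open>auto simp: vars_def\<close>)

section \<open>Polynomials in a prescribed set of variables\<close>

lemma polys_0 [simp]: "0 \<in> polys V"
  by (auto simp: polys_def vars_def)

lemma polys_Const [simp]: "Const c \<in> polys V"
  by (auto simp: polys_def vars_def Const_def)

lemma polys_Var: "i \<in> V \<Longrightarrow> Var i \<in> polys V"
  by (auto simp: polys_def vars_def Var_def)

lemma polys_add: "p \<in> polys V \<Longrightarrow> q \<in> polys V \<Longrightarrow> p + q \<in> polys V"
  unfolding polys_def vars_def using Poly_Mapping.keys_add[of p q] by blast

lemma polys_uminus: "p \<in> polys V \<Longrightarrow> - p \<in> polys V"
  by (auto simp: polys_def vars_def in_keys_iff)

lemma polys_diff: "p \<in> polys V \<Longrightarrow> q \<in> polys V \<Longrightarrow> p - q \<in> polys V"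
  using polys_add[of p V "- q"] polys_uminus[of q V] by simp

lemma polys_mult:
  assumes "p \<in> polys V" "q \<in> polys V"
  shows "p * q \<in> polys V"
  unfolding polys_def vars_def
proof clarify
  fix m i assume "m \<in> Poly_Mapping.keys (p * q)" and i: "i \<in> Poly_Mapping.keys m"
  then obtain a b where "a \<in> Poly_Mapping.keys p" "b \<in> Poly_Mapping.keys q" "m = a + b"
    using Poly_Mapping.keys_mult[of p q] by blast
  then show "i \<in> V"
    using assms i Poly_Mapping.keys_add[of a b] unfolding polys_def vars_def by blast
qed

lemma polys_sum: "(\<And>i. i \<in> S \<Longrightarrow> p i \<in> polys V) \<Longrightarrow> (\<Sum>i\<in>S. p i) \<in> polys V"
  by (induction S rule: infinite_finite_induct) (auto intro: polys_add)

lemma polys_mono: "p \<in> polys V \<Longrightarrow> V \<subseteq> W \<Longrightarrow> p \<in> polys W"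
  by (auto simp: polys_def)

lemma polys_Int: "p \<in> polys V \<Longrightarrow> p \<in> polys W \<Longrightarrow> p \<in> polys (V \<inter> W)"
  by (auto simp: polys_def)

section \<open>Total degree\<close>

lemma total_degree_le_iff:
  "total_degree p \<le> n \<longleftrightarrow>
    (\<forall>m\<in>Poly_Mapping.keys p. (\<Sum>i\<in>Poly_Mapping.keys m. Poly_Mapping.lookup m i) \<le> n)"
  by (simp add: total_degree_def)

lemma total_degree_add_le: "total_degree p \<le> n \<Longrightarrow> total_degree q \<le> n \<Longrightarrow> total_degree (p + q) \<le> n"
  unfolding total_degree_le_iff using Poly_Mapping.keys_add[of p q] by blast

lemma total_degree_uminus [simp]: "total_degree (- p) = total_degree p"
proof -
  have "Poly_Mapping.keys (- p) = Poly_Mapping.keys p"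
    by (auto simp: in_keys_iff)
  then show ?thesis by (simp add: total_degree_def)
qed

lemma total_degree_diff_le: "total_degree p \<le> n \<Longrightarrow> total_degree q \<le> n \<Longrightarrow> total_degree (p - q) \<le> n"
  using total_degree_add_le[of p n "- q"] by simp

lemma total_degree_sum_le:
  "(\<And>i. i \<in> S \<Longrightarrow> total_degree (p i) \<le> n) \<Longrightarrow> total_degree (\<Sum>i\<in>S. p i) \<le> n"
proof (induction S rule: infinite_finite_induct)
  case (insert x F)
  then show ?case by (simp add: total_degree_add_le)
qed (auto simp: total_degree_def)

lemma total_degree_Const [simp]: "total_degree (Const c) = 0"
  by (simp add: total_degree_def Const_def)

lemma total_degree_Const_Var: "total_degree (Const c * Var i) \<le> 1"
  by (simp add: total_degree_le_iff Const_def Var_def mult_single)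

lemma total_degree_Var_Const_Var: "total_degree (Var i * Const c * Var j) \<le> 2"
proof -
  let ?m = "Poly_Mapping.single i (1::nat) + Poly_Mapping.single j 1"
  have "(\<Sum>k\<in>Poly_Mapping.keys ?m. Poly_Mapping.lookup ?m k) \<le>
        (\<Sum>k\<in>{i, j}. Poly_Mapping.lookup ?m k)"
    by (rule sum_mono2) (use Poly_Mapping.keys_add[of "Poly_Mapping.single i (1::nat)" "Poly_Mapping.single j 1"] in auto)
  also have "\<dots> = 2"
    by (cases "i = j") (auto simp: lookup_add lookup_single)
  finally show ?thesis
    by (auto simp: total_degree_le_iff Const_def Var_def mult_single)
qed

section \<open>Sums of squares\<close>

lemma sos_0: "sos 0"
  unfolding sos_def by (rule exI[of _ "[]"]) simp

lemma sos_power2: "sos (p ^ 2)"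
  unfolding sos_def by (rule exI[of _ "[p]"]) simp

lemma sos_add: "sos p \<Longrightarrow> sos q \<Longrightarrow> sos (p + q)"
  unfolding sos_def
proof clarify
  fix ps qs :: "mpoly list"
  show "\<exists>rs. (\<Sum>q\<leftarrow>ps. q\<^sup>2) + (\<Sum>q\<leftarrow>qs. q\<^sup>2) = (\<Sum>q\<leftarrow>rs. q\<^sup>2)"
    by (rule exI[of _ "ps @ qs"]) simp
qed

lemma sos_Const: "0 \<le> c \<Longrightarrow> sos (Const c)"
  using sos_power2[of "Const (sqrt c)"] by (simp add: power2_eq_square flip: Const_mult)

lemma eval_mpoly_sos: "sos p \<Longrightarrow> 0 \<le> eval_mpoly w p"
proof -
  have "0 \<le> eval_mpoly w (\<Sum>q\<leftarrow>qs. q\<^sup>2)" for qs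
    by (induction qs) (auto simp: power2_eq_square)
  then show "sos p \<Longrightarrow> 0 \<le> eval_mpoly w p" by (auto simp: sos_def)
qed

section \<open>Concave quadratics\<close>

text \<open>The shape of \<open>concave_quadratic\<close> for an arbitrary coefficient matrix, so
  that identities between coefficients can be proved apart from semidefiniteness.\<close>

definition quad :: "var set \<Rightarrow> (var \<Rightarrow> var \<Rightarrow> real) \<Rightarrow> (var \<Rightarrow> real) \<Rightarrow> real \<Rightarrow> mpoly" where
  "quad V A \<alpha> a = (\<Sum>i\<in>V. \<Sum>j\<in>V. Var i * Const (A i j) * Var j) +
     2 * (\<Sum>i\<in>V. Const (\<alpha> i) * Var i) + Const a"

lemma concave_quadratic_iff_quad:
  "concave_quadratic V p \<longleftrightarrow> (\<exists>A \<alpha> a. neg_semidef V A \<and> p = quad V A \<alpha> a)"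
  by (simp add: concave_quadratic_def quad_def)

lemma eval_mpoly_quad:
  "eval_mpoly w (quad V A \<alpha> a) =
     (\<Sum>i\<in>V. \<Sum>j\<in>V. w i * A i j * w j) + 2 * (\<Sum>i\<in>V. \<alpha> i * w i) + a"
  by (simp add: quad_def)

lemma quad_in_polys: "quad V A \<alpha> a \<in> polys V"
  unfolding quad_def two_eq_Const
  by (intro polys_add polys_sum polys_mult polys_Const polys_Var)

lemma total_degree_quad: "total_degree (quad V A \<alpha> a) \<le> 2"
proof -
  have "2 * (\<Sum>i\<in>V. Const (\<alpha> i) * Var i) = (\<Sum>i\<in>V. Const (2 * \<alpha> i) * Var i)"
    by (simp add: sum_distrib_left Const_mult two_eq_Const mult.assoc)
  also have "total_degree \<dots> \<le> 2"
    by (rule total_degree_sum_le) (use total_degree_Const_Var in \<open>force intro: order_trans\<close>)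
  finally show ?thesis
    unfolding quad_def
    by (intro total_degree_add_le total_degree_sum_le total_degree_Var_Const_Var) auto
qed

lemma concave_quadratic_in_polys: "concave_quadratic V p \<Longrightarrow> p \<in> polys V"
  by (auto simp: concave_quadratic_iff_quad quad_in_polys)

lemma concave_quadratic_total_degree: "concave_quadratic V p \<Longrightarrow> total_degree p \<le> 2"
  by (auto simp: concave_quadratic_iff_quad total_degree_quad)

lemma concave_quadratic_add:
  assumes "concave_quadratic V p" "concave_quadratic V q"
  shows "concave_quadratic V (p + q)"
proof -
  obtain A \<alpha> a B \<beta> b where "neg_semidef V A" "p = quad V A \<alpha> a" "neg_semidef V B" "q = quad V B \<beta> b"
    using assms by (auto simp: concave_quadratic_iff_quad)
  moreover have "quad V A \<alpha> a + quad V B \<beta> b = quad V (\<lambda>i j. A i j + B i j) (\<lambda>i. \<alpha> i + \<beta> i) (a + b)"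
    by (simp add: quad_def Const_add algebra_simps sum.distrib)
  moreover have "neg_semidef V (\<lambda>i j. A i j + B i j)"
    using \<open>neg_semidef V A\<close> \<open>neg_semidef V B\<close>
    by (auto simp: neg_semidef_def algebra_simps sum.distrib intro: add_nonpos_nonpos)
  ultimately show ?thesis
    by (auto simp: concave_quadratic_iff_quad)
qed

lemma concave_quadratic_Const_mult:
  assumes "0 \<le> c" "concave_quadratic V p"
  shows "concave_quadratic V (Const c * p)"
proof -
  obtain A \<alpha> a where A: "neg_semidef V A" and "p = quad V A \<alpha> a"
    using assms by (auto simp: concave_quadratic_iff_quad)
  moreover have "Const c * quad V A \<alpha> a = quad V (\<lambda>i j. c * A i j) (\<lambda>i. c * \<alpha> i) (c * a)"
    by (simp add: quad_def Const_mult algebra_simps sum_distrib_left)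
  moreover have "neg_semidef V (\<lambda>i j. c * A i j)"
    unfolding neg_semidef_def
  proof (intro conjI allI ballI)
    fix w :: "var \<Rightarrow> real"
    have "(\<Sum>i\<in>V. \<Sum>j\<in>V. w i * (c * A i j) * w j) = c * (\<Sum>i\<in>V. \<Sum>j\<in>V. w i * A i j * w j)"
      by (simp add: sum_distrib_left mult_ac)
    also have "\<dots> \<le> 0"
      using A assms(1) by (auto simp: neg_semidef_def mult_nonneg_nonpos)
    finally show "(\<Sum>i\<in>V. \<Sum>j\<in>V. w i * (c * A i j) * w j) \<le> 0" .
  qed (use A in \<open>auto simp: neg_semidef_def\<close>)
  ultimately show ?thesis
    by (auto simp: concave_quadratic_iff_quad)
qed

lemma concave_quadratic_Const: "concave_quadratic V (Const c)"
  unfolding concave_quadratic_def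
  by (rule exI[of _ "\<lambda>_ _. 0"], rule exI[of _ "\<lambda>_. 0"], rule exI[of _ c]) (auto simp: neg_semidef_def)

lemma concave_quadratic_sum:
  assumes "\<And>i. i \<in> S \<Longrightarrow> concave_quadratic V (p i)"
  shows "concave_quadratic V (\<Sum>i\<in>S. p i)"
  using assms
  by (induction S rule: infinite_finite_induct)
     (use concave_quadratic_Const[of V 0] in \<open>auto intro: concave_quadratic_add\<close>)

text \<open>Written in the argument order of the abstract mixing operation \<open>m\<close> of
  \<open>concave_alternative\<close>, with \<open>t\<close> weighing the first point.\<close>

definition mix :: "real \<Rightarrow> (var \<Rightarrow> real) \<Rightarrow> (var \<Rightarrow> real) \<Rightarrow> var \<Rightarrow> real" where
  "mix t w w' = (\<lambda>i. t * w i + (1 - t) * w' i)"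

text \<open>The affine part is interpolated exactly. The quadratic form exceeds its interpolation by
  \<open>- t * (1 - t)\<close> times its value at the difference of the two points, which is
  nonnegative by semidefiniteness.\<close>

lemma concave_quadratic_concave:
  assumes "concave_quadratic V p" "0 \<le> t" "t \<le> 1"
  shows "t * eval_mpoly w p + (1 - t) * eval_mpoly w' p \<le> eval_mpoly (mix t w w') p"
proof -
  obtain A \<alpha> a where A: "neg_semidef V A" and p: "p = quad V A \<alpha> a"
    using assms by (auto simp: concave_quadratic_iff_quad)
  define Q where "Q w = (\<Sum>i\<in>V. \<Sum>j\<in>V. w i * A i j * w j)" for w
  have "Q (mix t w w') = t * Q w + (1 - t) * Q w' - t * (1 - t) * Q (\<lambda>i. w i - w' i)"
    unfolding Q_def sum_distrib_left sum.distrib[symmetric] sum_subtractf[symmetric]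
    by (intro sum.cong refl) (simp add: mix_def algebra_simps)
  moreover have "t * (1 - t) * Q (\<lambda>i. w i - w' i) \<le> 0"
    using A assms(2,3) unfolding neg_semidef_def Q_def by (intro mult_nonneg_nonpos) auto
  moreover have "(\<Sum>i\<in>V. \<alpha> i * mix t w w' i) = t * (\<Sum>i\<in>V. \<alpha> i * w i) + (1 - t) * (\<Sum>i\<in>V. \<alpha> i * w' i)"
    unfolding sum_distrib_left sum.distrib[symmetric]
    by (intro sum.cong refl) (simp add: mix_def algebra_simps)
  ultimately show ?thesis
    by (simp add: p eval_mpoly_quad Q_def algebra_simps)
qed

section \<open>Completing squares\<close>

text \<open>For fixed other variables \<open>q\<close> is a concave parabola or an affine function
  of \<open>v\<close>, while \<open>p\<close> does not change. If the leading coefficient is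
  negative, completing the square replaces \<open>q\<close> by its maximum over \<open>v\<close>;
  the bound survives because the maximum is attained. If the coefficient is zero, boundedness above
  keeps \<open>v\<close> from occurring at all, and \<open>h = 0\<close> will do.\<close>

lemma eliminate_variable:
  assumes V: "finite V" "v \<notin> V"
    and q: "concave_quadratic (insert v V) q"
    and p: "v \<notin> vars p"
    and nonpos: "\<And>w. eval_mpoly w q + eval_mpoly w p \<le> 0"
  shows "\<exists>h. sos h \<and> concave_quadratic V (q + h) \<and>
           (\<forall>w. eval_mpoly w (q + h) + eval_mpoly w p \<le> 0)"
proof -
  obtain A \<alpha> a where A: "neg_semidef (insert v V) A" and qA: "q = quad (insert v V) A \<alpha> a"
    using q by (auto simp: concave_quadratic_iff_quad)
  have sym: "A i v = A v i" if "i \<in> V" for i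
    using A that unfolding neg_semidef_def by blast
  define lin where "lin w = (\<Sum>j\<in>V. A v j * w j)" for w
  have form: "(\<Sum>i\<in>insert v V. \<Sum>j\<in>insert v V. w i * A i j * w j) =
      A v v * (w v)\<^sup>2 + 2 * w v * lin w + (\<Sum>i\<in>V. \<Sum>j\<in>V. w i * A i j * w j)" for w
  proof -
    have "(\<Sum>i\<in>V. w i * A i v * w v) = w v * lin w"
      by (simp add: lin_def sum_distrib_left mult_ac sym cong: sum.cong)
    moreover have "(\<Sum>j\<in>V. w v * A v j * w j) = w v * lin w"
      by (simp add: lin_def sum_distrib_left mult_ac)
    ultimately show ?thesis
      using V by (simp add: sum.distrib power2_eq_square)
  qed
  have upd_V: "(\<Sum>i\<in>V. \<Sum>j\<in>V. (w(v := t)) i * B i j * (w(v := t)) j) = (\<Sum>i\<in>V. \<Sum>j\<in>V. w i * B i j * w j)"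
    "lin (w(v := t)) = lin w"
    for w t and B :: "var \<Rightarrow> var \<Rightarrow> real"
    using V unfolding lin_def by (auto intro!: sum.cong)
  \<comment> \<open>Semidefiniteness as a bound on a quadratic in the \<open>v\<close>-coordinate
    \<open>t\<close>, which can then be chosen freely.\<close>
  have A_neg: "A v v * t\<^sup>2 + 2 * t * lin w + (\<Sum>i\<in>V. \<Sum>j\<in>V. w i * A i j * w j) \<le> 0" for w t
  proof -
    have "(\<Sum>i\<in>insert v V. \<Sum>j\<in>insert v V. (w(v := t)) i * A i j * (w(v := t)) j) \<le> 0"
      using A unfolding neg_semidef_def by blast
    then show ?thesis unfolding form upd_V by simp
  qed
  have eval_p: "eval_mpoly (w(v := t)) p = eval_mpoly w p" for w t
    by (rule eval_mpoly_cong) (use p in auto)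
  define S where "S = (\<Sum>i\<in>V. \<Sum>j\<in>V. Var i * Const (A i j) * Var j)"
  define T where "T = (\<Sum>i\<in>V. Const (\<alpha> i) * Var i)"
  define L where "L = (\<Sum>j\<in>V. Const (A v j) * Var j)"
  have eval_L: "eval_mpoly w L = lin w" for w
    by (simp add: L_def lin_def)
  have q_eq: "q = Const (A v v) * Var v * Var v + 2 * Var v * L + S + 2 * (Const (\<alpha> v) * Var v + T) + Const a"
  proof -
    have "(\<Sum>i\<in>V. Var i * Const (A i v) * Var v) = Var v * L"
      by (simp add: L_def sum_distrib_left mult_ac sym cong: sum.cong)
    moreover have "(\<Sum>j\<in>V. Var v * Const (A v j) * Var j) = Var v * L"
      by (simp add: L_def sum_distrib_left mult_ac)
    ultimately show ?thesis
      using V by (simp add: qA quad_def S_def T_def sum.distrib algebra_simps)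
  qed
  show ?thesis
  proof (cases "A v v = 0")
    case True
    have affine_zero: "l = 0" if "\<And>t. l * t + k \<le> 0" for l k :: real
    proof (rule ccontr)
      assume "l \<noteq> 0"
      \<comment> \<open>At this point the affine function takes the value 1.\<close>
      then show False using that[of "(1 - k) / l"] by simp
    qed
    have lin0: "lin w = 0" for w
    proof -
      have "2 * lin w = 0"
      proof (rule affine_zero)
        show "2 * lin w * t + (\<Sum>i\<in>V. \<Sum>j\<in>V. w i * A i j * w j) \<le> 0" for t
          using A_neg[of t w] True by (simp add: mult_ac)
      qed
      then show ?thesis by simp
    qed
    have Av: "A v j = 0" if "j \<in> V" for j
    proof -
      have "lin (\<lambda>i. if i = j then 1 else 0) = A v j"
        using V that by (simp add: lin_def if_distrib[of "(*) _"] cong: if_cong)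
      then show ?thesis using lin0 by simp
    qed
    then have "L = 0" by (simp add: L_def)
    \<comment> \<open>On the \<open>v\<close>-axis \<open>q\<close> reduces to
      \<open>2 * \<alpha> v * t + a\<close> and \<open>p\<close> is constant, so the slope must
      vanish.\<close>
    have "\<alpha> v = 0"
    proof (rule ccontr)
      let ?w = "\<lambda>t. (\<lambda>_. 0)(v := t)"
      have "eval_mpoly (?w t) S = 0" "eval_mpoly (?w t) T = 0" for t
        using V unfolding S_def T_def by (auto intro!: sum.neutral)
      then have "2 * \<alpha> v * t + (a + eval_mpoly (\<lambda>_. 0) p) \<le> 0" for t
        using nonpos[of "?w t"] eval_p[of "\<lambda>_. 0" t]
        by (simp add: q_eq True \<open>L = 0\<close>)
      from affine_zero[OF this] show "\<alpha> v \<noteq> 0 \<Longrightarrow> False" by simp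
    qed
    then have "q = quad V A \<alpha> a"
      by (simp add: q_eq True \<open>L = 0\<close> quad_def S_def T_def)
    moreover have "neg_semidef V A"
      using A A_neg[of 0] by (auto simp: neg_semidef_def)
    ultimately show ?thesis
      using nonpos sos_0 by (intro exI[of _ 0]) (auto simp: concave_quadratic_iff_quad)
  next
    case False
    define c where "c = - A v v"
    have "A v v \<le> 0"
      using A_neg[of 1 "\<lambda>_. 0"] by (simp add: lin_def)
    then have c: "c > 0" "A v v = - c" using False by (auto simp: c_def)
    define s where "s = sqrt c"
    have s: "s \<noteq> 0" "s * s = c" using c by (auto simp: s_def)
    \<comment> \<open>This square cancels every term of \<open>q\<close> containing
      \<open>v\<close>: the factors \<open>s\<close> and \<open>1 / s\<close> produce the
      coefficient \<open>c\<close> of the square of \<open>v\<close> and a cross term free of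
      roots.\<close>
    define h where "h = (Const s * Var v - Const (1 / s) * (L + Const (\<alpha> v)))\<^sup>2"
    \<comment> \<open>\<open>B\<close> is the Schur complement of the entry \<open>A v v\<close>;
      the sign is plus because \<open>A v v = - c\<close>. Likewise \<open>\<beta>\<close> and
      \<open>b\<close> are the coefficients left after elimination.\<close>
    define B where "B i j = A i j + A v i * A v j / c" for i j
    define \<beta> where "\<beta> i = \<alpha> i + A v i * \<alpha> v / c" for i
    define b where "b = a + (\<alpha> v)\<^sup>2 / c"
    have ss: "Const s * Const s = Const c" "Const s * Const (1 / s) = 1"
      "Const (1 / s) * Const (1 / s) = Const (1 / c)"
      using s by (simp_all flip: Const_mult add: power2_eq_square)
    have h_eq: "h = Const c * Var v * Var v - 2 * Var v * (L + Const (\<alpha> v)) +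
        Const (1 / c) * (L + Const (\<alpha> v)) * (L + Const (\<alpha> v))"
    proof -
      have "h = (Const s * Const s) * Var v * Var v
          - 2 * (Const s * Const (1 / s)) * Var v * (L + Const (\<alpha> v))
          + (Const (1 / s) * Const (1 / s)) * (L + Const (\<alpha> v)) * (L + Const (\<alpha> v))"
        by (simp add: h_def power2_eq_square algebra_simps)
      then show ?thesis by (simp only: ss) simp
    qed
    have LL: "(\<Sum>i\<in>V. \<Sum>j\<in>V. Var i * Const (A v i * A v j / c) * Var j) = Const (1 / c) * L * L"
    proof -
      have "Const (A v i * A v j / c) = Const (1 / c) * Const (A v i) * Const (A v j)" for i j
        by (simp flip: Const_mult)
      then show ?thesis
        by (simp add: L_def sum_distrib_left sum_distrib_right sum_product mult_ac)
    qed
    have La: "(\<Sum>i\<in>V. Const (A v i * \<alpha> v / c) * Var i) = Const (1 / c) * Const (\<alpha> v) * L"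
    proof -
      have "Const (A v i * \<alpha> v / c) = Const (1 / c) * Const (A v i) * Const (\<alpha> v)" for i
        by (simp flip: Const_mult)
      then show ?thesis
        by (simp add: L_def sum_distrib_left mult_ac)
    qed
    have b: "Const b = Const a + Const (1 / c) * Const (\<alpha> v) * Const (\<alpha> v)"
      by (simp add: b_def power2_eq_square flip: Const_mult Const_add)
    have "quad V B \<beta> b = S + Const (1 / c) * L * L + 2 * (T + Const (1 / c) * Const (\<alpha> v) * L) + Const b"
      unfolding quad_def B_def \<beta>_def Const_add S_def T_def LL[symmetric] La[symmetric]
      by (simp add: algebra_simps sum.distrib)
    then have qh: "q + h = quad V B \<beta> b"
      unfolding q_eq h_eq c(2) b Const_uminus by (simp add: algebra_simps)
    have "neg_semidef V B"
      unfolding neg_semidef_def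
    proof (intro conjI ballI allI)
      fix i j assume "i \<in> V" "j \<in> V"
      then have "A i j = A j i" using A unfolding neg_semidef_def by blast
      then show "B i j = B j i" by (simp add: B_def)
    next
      fix w :: "var \<Rightarrow> real"
      have "(\<Sum>i\<in>V. \<Sum>j\<in>V. w i * B i j * w j) =
          (\<Sum>i\<in>V. \<Sum>j\<in>V. w i * A i j * w j) + (\<Sum>i\<in>V. \<Sum>j\<in>V. (A v i * w i) * (A v j * w j)) / c"
        by (simp add: B_def algebra_simps sum.distrib sum_divide_distrib)
      also have "\<dots> = (\<Sum>i\<in>V. \<Sum>j\<in>V. w i * A i j * w j) + (lin w)\<^sup>2 / c"
        by (simp add: lin_def power2_eq_square sum_product)
      \<comment> \<open>The rank-one correction is the maximum over \<open>t\<close> of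
        \<open>A v v * t^2 + 2 * t * lin w\<close>, attained at \<open>t = lin w / c\<close>, so
        \<open>A_neg\<close> at this \<open>t\<close> gives the bound.\<close>
      also have "\<dots> = A v v * (lin w / c)\<^sup>2 + 2 * (lin w / c) * lin w + (\<Sum>i\<in>V. \<Sum>j\<in>V. w i * A i j * w j)"
        using c by (simp add: power2_eq_square field_simps)
      also have "\<dots> \<le> 0" by (rule A_neg)
      finally show "(\<Sum>i\<in>V. \<Sum>j\<in>V. w i * B i j * w j) \<le> 0" .
    qed
    then have "concave_quadratic V (q + h)"
      unfolding qh concave_quadratic_iff_quad by blast
    moreover have "eval_mpoly w (q + h) + eval_mpoly w p \<le> 0" for w
    proof -
      \<comment> \<open>Moving \<open>v\<close> to the vertex makes \<open>h\<close> vanish. Neither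
        \<open>q + h\<close> nor \<open>p\<close> depends on \<open>v\<close>, so the bound at
        \<open>w\<close> is the hypothesis at \<open>w'\<close>.\<close>
      define w' where "w' = w(v := (lin w + \<alpha> v) / c)"
      have "eval_mpoly w (q + h) = eval_mpoly w' (q + h)"
        unfolding qh by (rule eval_mpoly_cong)
          (use quad_in_polys[of V B \<beta> b] V in \<open>auto simp: w'_def polys_def\<close>)
      moreover have "eval_mpoly w' h = 0"
      proof -
        have "eval_mpoly w' h = (s * (w' v) - (1 / s) * (lin w' + \<alpha> v))\<^sup>2"
          by (simp add: h_def power2_eq_square eval_L)
        moreover have "w' v = (lin w + \<alpha> v) / (s * s)" "lin w' = lin w"
          using s by (simp_all add: w'_def upd_V)
        ultimately show ?thesis using s(1) by simp
      qed
      ultimately show ?thesis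
        using nonpos[of w'] eval_p[of w] by (simp add: w'_def)
    qed
    moreover have "sos h" unfolding h_def by (rule sos_power2)
    ultimately show ?thesis by blast
  qed
qed

text \<open>The variables of \<open>T\<close> go one at a time: each step absorbs its square into
  \<open>q\<close>, while \<open>p\<close> stays fixed and bounds are carried along.\<close>

lemma eliminate_variables:
  assumes "finite T" "finite V" "V \<inter> T = {}" "concave_quadratic (V \<union> T) q" "vars p \<inter> T = {}"
    and "\<And>w. eval_mpoly w q + eval_mpoly w p \<le> 0"
  shows "\<exists>h. sos h \<and> concave_quadratic V (q + h) \<and>
           (\<forall>w. eval_mpoly w (q + h) + eval_mpoly w p \<le> 0)"
  using assms
proof (induction T arbitrary: q rule: finite_induct)
  case empty
  then show ?case using sos_0 by (intro exI[of _ 0]) auto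
next
  case (insert v T)
  have "\<exists>h. sos h \<and> concave_quadratic (V \<union> T) (q + h) \<and>
      (\<forall>w. eval_mpoly w (q + h) + eval_mpoly w p \<le> 0)"
    by (rule eliminate_variable[where v = v]) (use insert.prems insert.hyps in auto)
  then obtain h where h: "sos h" "concave_quadratic (V \<union> T) (q + h)"
    "\<And>w. eval_mpoly w (q + h) + eval_mpoly w p \<le> 0" by blast
  have "\<exists>h'. sos h' \<and> concave_quadratic V (q + h + h') \<and>
      (\<forall>w. eval_mpoly w (q + h + h') + eval_mpoly w p \<le> 0)"
    by (rule insert.IH) (use insert.prems h in auto)
  then obtain h' where "sos h'" "concave_quadratic V (q + h + h')"
      "\<forall>w. eval_mpoly w (q + h + h') + eval_mpoly w p \<le> 0" by blast
  then show ?case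
    using h(1) by (intro exI[of _ "h + h'"]) (auto simp: sos_add add.assoc)
qed

text \<open>Eliminate \<open>T\<close> from the first summand and \<open>U\<close> from the second; the sum of the remainders
  only involves \<open>V\<close>, and eliminating \<open>V\<close> as well leaves a nonpositive constant.\<close>

lemma split_nonpositive_concave_quadratic:
  assumes fin: "finite V" "finite T" "finite U" and disj: "V \<inter> T = {}" "V \<inter> U = {}" "T \<inter> U = {}"
    and p: "concave_quadratic (V \<union> T) p" and q: "concave_quadratic (V \<union> U) q"
    and nonpos: "\<And>w. eval_mpoly w p + eval_mpoly w q \<le> 0"
  obtains h1 h2 where "sos h1" "h1 \<in> polys (V \<union> T)" "total_degree h1 \<le> 2"
    "sos h2" "h2 \<in> polys (V \<union> U)" "total_degree h2 \<le> 2" "p + q + h1 + h2 = 0"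
proof -
  have "vars q \<inter> T = {}"
    using concave_quadratic_in_polys[OF q] disj by (auto simp: polys_def)
  then obtain h1 where h1: "sos h1" and p': "concave_quadratic V (p + h1)"
    and nonpos1: "\<And>w. eval_mpoly w (p + h1) + eval_mpoly w q \<le> 0"
    using eliminate_variables[OF fin(2,1) disj(1) p _ nonpos] by blast
  \<comment> \<open>The roles are now exchanged: \<open>p + h1\<close> involves only
    \<open>V\<close>, so it can stay fixed while \<open>U\<close> is eliminated from
    \<open>q\<close>.\<close>
  have "vars (p + h1) \<inter> U = {}"
    using concave_quadratic_in_polys[OF p'] disj by (auto simp: polys_def)
  then obtain h2 where h2: "sos h2" and q': "concave_quadratic V (q + h2)"
    and nonpos2: "\<And>w. eval_mpoly w (q + h2) + eval_mpoly w (p + h1) \<le> 0"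
    using eliminate_variables[OF fin(3,1) disj(2) q, of "p + h1"] nonpos1
    by (metis add.commute)
  have pq: "concave_quadratic ({} \<union> V) (p + h1 + (q + h2))"
    using concave_quadratic_add[OF p' q'] by simp
  have "\<And>w. eval_mpoly w (p + h1 + (q + h2)) + eval_mpoly w 0 \<le> 0"
    using nonpos2 by (simp add: algebra_simps)
  then obtain h3 where h3: "sos h3" and r: "concave_quadratic {} (p + h1 + (q + h2) + h3)"
    and nonpos3: "\<And>w. eval_mpoly w (p + h1 + (q + h2) + h3) \<le> 0"
    using eliminate_variables[OF fin(1) _ _ pq, of 0] by (auto simp: vars_def)
  obtain k where k: "p + h1 + (q + h2) + h3 = Const k"
    using r by (auto simp: concave_quadratic_def)
  have "k \<le> 0" using nonpos3[of "\<lambda>_. 0"] k by simp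
  have k': "Const k = p + h1 + (q + h2) + h3" using k ..
  \<comment> \<open>The leftover square part \<open>h3\<close> and the nonnegative constant
    \<open>- k\<close> are charged to the first summand. Variables and degrees are then read off the
    next two identities instead of being tracked through the eliminations.\<close>
  let ?h1 = "h1 + h3 + Const (- k)"
  have h1_eq: "?h1 = - p - (q + h2)" and h2_eq: "h2 = (q + h2) - q"
    unfolding Const_uminus k' by simp_all
  show thesis
  proof
    show "sos ?h1" "sos h2"
      using h1 h2 h3 \<open>k \<le> 0\<close> by (auto intro!: sos_add sos_Const)
    show "?h1 \<in> polys (V \<union> T)"
      unfolding h1_eq
      by (intro polys_diff polys_uminus concave_quadratic_in_polys[OF p]
          polys_mono[OF concave_quadratic_in_polys[OF q']]) simp
    show "total_degree ?h1 \<le> 2"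
      unfolding h1_eq
      by (intro total_degree_diff_le) (simp_all add: concave_quadratic_total_degree[OF p] concave_quadratic_total_degree[OF q'])
    show "h2 \<in> polys (V \<union> U)"
      by (subst h2_eq, intro polys_diff concave_quadratic_in_polys[OF q]
          polys_mono[OF concave_quadratic_in_polys[OF q']]) simp
    show "total_degree h2 \<le> 2"
      by (subst h2_eq, intro total_degree_diff_le)
        (simp_all add: concave_quadratic_total_degree[OF q] concave_quadratic_total_degree[OF q'])
    show "p + q + ?h1 + h2 = 0"
      unfolding h1_eq by simp
  qed
qed

section \<open>A theorem of the alternative for concave functions\<close>

text \<open>Weak separation of the origin from a convex set, seen only through the coordinates in
  \<open>N\<close>. If coordinate \<open>k\<close> has one sign on \<open>C\<close>, it separates up
  to sign. Otherwise a functional separating the slice where coordinate \<open>k\<close> vanishes is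
  extended by a suitable coefficient at \<open>k\<close>, as in the Hahn-Banach theorem.\<close>

lemma separate_zero:
  fixes C :: "('i \<Rightarrow> real) set"
  assumes "finite N" "C \<noteq> {}"
    and "\<And>c c' t. c \<in> C \<Longrightarrow> c' \<in> C \<Longrightarrow> 0 \<le> t \<Longrightarrow> t \<le> 1 \<Longrightarrow> (\<lambda>i. t * c i + (1 - t) * c' i) \<in> C"
    and "\<And>c. c \<in> C \<Longrightarrow> \<exists>i\<in>N. c i \<noteq> 0"
  shows "\<exists>a. (\<exists>i\<in>N. a i \<noteq> 0) \<and> (\<forall>c\<in>C. (\<Sum>i\<in>N. a i * c i) \<le> 0)"
  using assms
proof (induction N arbitrary: C rule: finite_induct)
  case empty
  then show ?case by blast
next
  case (insert k N)
  note conv = insert.prems(2)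
  have sum_unit: "(\<Sum>i\<in>insert k N. (if i = k then e else 0) * c i) = e * c k" for e and c :: "'i \<Rightarrow> real"
  proof -
    have "(\<Sum>i\<in>N. (if i = k then e else 0) * c i) = 0"
      using insert.hyps by (intro sum.neutral) auto
    then show ?thesis using insert.hyps by simp
  qed
  show ?case
  proof (cases "(\<exists>c\<in>C. c k > 0) \<and> (\<exists>c\<in>C. c k < 0)")
    case False
    then consider "\<forall>c\<in>C. c k \<le> 0" | "\<forall>c\<in>C. c k \<ge> 0"
      by (meson not_le)
    then obtain e :: real where "e \<noteq> 0" "\<forall>c\<in>C. e * c k \<le> 0"
    proof cases
      case 1 then show ?thesis using that[of 1] by simp
    next
      case 2 then show ?thesis using that[of "-1"] by simp
    qed
    then show ?thesis
      by (intro exI[of _ "\<lambda>i. if i = k then e else 0"]) (simp only: sum_unit, simp)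
  next
    case True
    then obtain p0 n0 where p0: "p0 \<in> C" "p0 k > 0" and n0: "n0 \<in> C" "n0 k < 0" by blast
    define C0 where "C0 = {c \<in> C. c k = 0}"
    \<comment> \<open>The point where the segment from \<open>p\<close> to \<open>n\<close> meets
      the slice, stated after clearing the denominator \<open>p k - n k\<close>.\<close>
    have cross: "\<exists>c\<in>C0. \<forall>i. (p k - n k) * c i = p k * n i - n k * p i"
      if "p \<in> C" "p k > 0" "n \<in> C" "n k < 0" for p n
    proof -
      define t where "t = - n k / (p k - n k)"
      have t: "0 \<le> t" "t \<le> 1" using that by (auto simp: t_def field_simps)
      have eq: "(p k - n k) * (t * p i + (1 - t) * n i) = p k * n i - n k * p i" for i
      proof -
        have "(p k - n k) * t = - n k" "(p k - n k) * (1 - t) = p k"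
          using that by (simp_all add: t_def field_simps)
        moreover have "(p k - n k) * (t * p i + (1 - t) * n i) =
            ((p k - n k) * t) * p i + ((p k - n k) * (1 - t)) * n i"
          by (simp add: algebra_simps)
        ultimately show ?thesis by simp
      qed
      have "(\<lambda>i. t * p i + (1 - t) * n i) \<in> C0"
        using conv[OF that(1,3) t] eq[of k] that by (simp add: C0_def)
      then show ?thesis by (rule bexI[rotated]) (use eq in simp)
    qed
    have "\<exists>a. (\<exists>i\<in>N. a i \<noteq> 0) \<and> (\<forall>c\<in>C0. (\<Sum>i\<in>N. a i * c i) \<le> 0)"
    proof (rule insert.IH)
      show "C0 \<noteq> {}" using cross[OF p0 n0] by blast
      show "(\<lambda>i. t * c i + (1 - t) * c' i) \<in> C0"
        if "c \<in> C0" "c' \<in> C0" "0 \<le> t" "t \<le> 1" for c c' t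
        using that conv by (simp add: C0_def)
      show "\<exists>i\<in>N. c i \<noteq> 0" if "c \<in> C0" for c
        using that insert.prems(3)[of c] by (auto simp: C0_def)
    qed
    then obtain a where a: "\<exists>i\<in>N. a i \<noteq> 0" and neg: "\<And>c. c \<in> C0 \<Longrightarrow> (\<Sum>i\<in>N. a i * c i) \<le> 0"
      by blast
    define S where "S c = (\<Sum>i\<in>N. a i * c i)" for c :: "'i \<Rightarrow> real"
    \<comment> \<open>Points with negative coordinate \<open>k\<close> bound the new coefficient
      from below, points with positive coordinate from above. Applying \<open>a\<close> at the
      crossing point shows that every lower bound is at most every upper bound.\<close>
    have le: "S n / - n k \<le> - S p / p k" if pn: "p \<in> C" "p k > 0" "n \<in> C" "n k < 0" for p n
    proof -
      obtain c where c: "c \<in> C0" "\<And>i. (p k - n k) * c i = p k * n i - n k * p i"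
        using cross[OF pn] by blast
      have "(p k - n k) * S c = p k * S n - n k * S p"
        unfolding S_def sum_distrib_left sum_subtractf[symmetric]
        proof (intro sum.cong refl)
          fix i
          have "(p k - n k) * (a i * c i) = a i * ((p k - n k) * c i)" by simp
          also have "\<dots> = p k * (a i * n i) - n k * (a i * p i)"
            by (subst c(2)) (simp add: algebra_simps)
          finally show "(p k - n k) * (a i * c i) = p k * (a i * n i) - n k * (a i * p i)" .
        qed
      moreover have "(p k - n k) * S c \<le> 0"
        using neg[OF c(1)] pn unfolding S_def by (intro mult_nonneg_nonpos) auto
      ultimately show ?thesis using pn by (simp add: field_simps)
    qed
    \<comment> \<open>\<open>L\<close> collects the lower bounds; it is nonempty by
      \<open>n0\<close> and bounded by \<open>p0\<close>. Its supremum satisfies all bounds on both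
      sides.\<close>
    define L where "L = (\<lambda>n. S n / - n k) ` {n \<in> C. n k < 0}"
    have L: "L \<noteq> {}" using n0 by (auto simp: L_def)
    have bdd: "bdd_above L"
      by (rule bdd_aboveI[of _ "- S p0 / p0 k"]) (use le p0 in \<open>auto simp: L_def\<close>)
    have lower: "S n / - n k \<le> Sup L" if "n \<in> C" "n k < 0" for n
      by (rule cSup_upper[OF _ bdd]) (use that in \<open>auto simp: L_def\<close>)
    have upper: "Sup L \<le> - S p / p k" if "p \<in> C" "p k > 0" for p
      by (rule cSup_least[OF L]) (use le that in \<open>auto simp: L_def\<close>)
    have "Sup L * c k + S c \<le> 0" if "c \<in> C" for c
    proof (cases "c k" "0::real" rule: linorder_cases)
      case less
      then show ?thesis using lower[OF that less] by (simp add: field_simps)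
    next
      case equal
      then show ?thesis using neg that by (simp add: S_def C0_def)
    next
      case greater
      then show ?thesis using upper[OF that greater] by (simp add: field_simps)
    qed
    moreover have "(\<Sum>i\<in>insert k N. (a(k := Sup L)) i * c i) = Sup L * c k + S c" for c
    proof -
      have "(\<Sum>i\<in>N. (a(k := Sup L)) i * c i) = S c"
        unfolding S_def using insert.hyps by (intro sum.cong) auto
      then show ?thesis using insert.hyps by simp
    qed
    moreover have "\<exists>i\<in>insert k N. (a(k := Sup L)) i \<noteq> 0"
      using a insert.hyps by auto
    ultimately show ?thesis by (intro exI[of _ "a(k := Sup L)"]) simp
  qed
qed

text \<open>Only concavity along the abstract mixing operation \<open>m\<close> is used, so points
  may be of any type. Separation yields multipliers; the real issue is that those of the strict
  constraints might all vanish, which \<open>nonneg_comb\<close> and an irredundant choice of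
  equations exclude.\<close>

lemma concave_alternative:
  fixes F :: "'i \<Rightarrow> 'w \<Rightarrow> real" and G :: "'j \<Rightarrow> 'w \<Rightarrow> real" and m :: "real \<Rightarrow> 'w \<Rightarrow> 'w \<Rightarrow> 'w"
  assumes fin: "finite A" "finite B"
    and concF: "\<And>i t w w'. i \<in> A \<Longrightarrow> 0 \<le> t \<Longrightarrow> t \<le> 1 \<Longrightarrow> t * F i w + (1 - t) * F i w' \<le> F i (m t w w')"
    and concG: "\<And>j t w w'. j \<in> B \<Longrightarrow> 0 \<le> t \<Longrightarrow> t \<le> 1 \<Longrightarrow> t * G j w + (1 - t) * G j w' \<le> G j (m t w w')"
    and nonneg_comb: "\<And>\<delta>. \<forall>i\<in>A. 0 \<le> \<delta> i \<Longrightarrow> \<forall>w. (\<Sum>i\<in>A. \<delta> i * F i w) \<le> 0 \<Longrightarrow>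
                        \<forall>w. (\<Sum>i\<in>A. \<delta> i * F i w) = 0"
    and infeasible: "\<nexists>w. (\<forall>i\<in>A. 0 \<le> F i w) \<and> (\<forall>j\<in>B. 0 < G j w)"
  obtains l \<eta> where "\<forall>i\<in>A. 0 \<le> l i" "\<forall>j\<in>B. 0 \<le> \<eta> j" "(\<Sum>j\<in>B. \<eta> j) = 1"
    "\<And>w. (\<Sum>i\<in>A. l i * F i w) + (\<Sum>j\<in>B. \<eta> j * G j w) \<le> 0"
proof -
  define null where "null \<delta> \<longleftrightarrow> (\<forall>i\<in>A. 0 \<le> \<delta> i) \<and> (\<forall>w. (\<Sum>i\<in>A. \<delta> i * F i w) = 0)" for \<delta> :: "'i \<Rightarrow> real"
  \<comment> \<open>Wherever all \<open>F i\<close> are nonnegative, a null combination forces those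
    of positive weight to vanish. The constraints in \<open>P\<close> are thus hidden
    equations.\<close>
  define P where "P = {i \<in> A. \<exists>\<delta>. null \<delta> \<and> \<delta> i > 0}"
  have PA: "P \<subseteq> A" "finite P" using fin by (auto simp: P_def)
  \<comment> \<open>Summing one witness per index gives a single null combination that is positive
    on all of \<open>P\<close>.\<close>
  obtain \<rho> where \<rho>: "null \<rho>" "\<And>i. i \<in> P \<Longrightarrow> \<rho> i > 0"
  proof -
    have "\<forall>i\<in>P. \<exists>\<delta>. null \<delta> \<and> \<delta> i > 0" by (auto simp: P_def)
    then obtain \<delta> where \<delta>: "\<And>i. i \<in> P \<Longrightarrow> null (\<delta> i)" "\<And>i. i \<in> P \<Longrightarrow> \<delta> i i > 0" by metis
    have nn: "0 \<le> \<delta> k i" if "k \<in> P" "i \<in> A" for k i using \<delta>(1)[OF that(1)] that by (auto simp: null_def)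
    have "(\<Sum>i\<in>A. (\<Sum>k\<in>P. \<delta> k i) * F i w) = (\<Sum>k\<in>P. \<Sum>i\<in>A. \<delta> k i * F i w)" for w
      unfolding sum_distrib_right by (rule sum.swap)
    also have "\<dots> w = 0" for w
      using \<delta>(1) by (intro sum.neutral) (auto simp: null_def)
    finally have "null (\<lambda>i. \<Sum>k\<in>P. \<delta> k i)"
      using nn by (auto simp: null_def intro: sum_nonneg)
    moreover have "(\<Sum>k\<in>P. \<delta> k i) > 0" if "i \<in> P" for i
      by (rule sum_pos2[of _ i]) (use that PA \<delta>(2) nn in auto)
    ultimately show ?thesis using that by blast
  qed
  have \<rho>0: "\<rho> i \<ge> 0" "\<rho> i > 0 \<Longrightarrow> i \<in> P" if "i \<in> A" for i
    using \<rho>(1) that by (auto simp: P_def null_def)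
  \<comment> \<open>A positively weighted sum of the concave functions \<open>F i\<close>, \<open>i \<in> P\<close>, vanishes, so each of them is affine.\<close>
  have affine: "F i (m t w w') = t * F i w + (1 - t) * F i w'" if "i \<in> P" "0 \<le> t" "t \<le> 1" for i t w w'
  proof -
    let ?gap = "\<lambda>i. \<rho> i * (F i (m t w w') - (t * F i w + (1 - t) * F i w'))"
    have "(\<Sum>i\<in>A. ?gap i) = (\<Sum>i\<in>A. \<rho> i * F i (m t w w')) -
        (t * (\<Sum>i\<in>A. \<rho> i * F i w) + (1 - t) * (\<Sum>i\<in>A. \<rho> i * F i w'))"
      unfolding sum_distrib_left sum.distrib[symmetric] sum_subtractf[symmetric]
      by (intro sum.cong refl) (simp add: algebra_simps)
    also have "\<dots> = 0" using \<rho>(1) by (simp add: null_def)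
    finally have "(\<Sum>i\<in>A. ?gap i) = 0" .
    moreover have "0 \<le> ?gap i" if "i \<in> A" for i
      using \<rho>0(1)[OF that] concF[OF that \<open>0 \<le> t\<close> \<open>t \<le> 1\<close>, of w w'] by simp
    ultimately have "?gap i = 0"
      using sum_nonneg_eq_0_iff[of A ?gap] fin(1) that(1) PA(1) by blast
    then show ?thesis using \<rho>(2)[OF that(1)] by simp
  qed
  define gen where "gen Q \<longleftrightarrow> (\<forall>w. (\<forall>i\<in>Q. F i w = 0) \<longrightarrow> (\<forall>i\<in>P. F i w = 0))" for Q
  \<comment> \<open>A minimal set of equations implying all those on \<open>P\<close>: no member of
    \<open>E\<close> is redundant. This is what yields the final contradiction when the multipliers
    of \<open>G\<close> vanish.\<close>
  obtain E where E: "E \<subseteq> P" "gen E" and E_min: "\<And>Q. Q \<subseteq> P \<Longrightarrow> gen Q \<Longrightarrow> Q \<subseteq> E \<Longrightarrow> E = Q"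
  proof -
    have "P \<in> {Q. Q \<subseteq> P \<and> gen Q}" by (simp add: gen_def)
    then have "\<exists>E\<in>{Q. Q \<subseteq> P \<and> gen Q}. \<forall>Q\<in>{Q. Q \<subseteq> P \<and> gen Q}. Q \<subseteq> E \<longrightarrow> E = Q"
      by (intro finite_has_minimal) (use PA(2) in auto)
    then obtain E where "E \<subseteq> P" "gen E" "\<forall>Q\<in>{Q. Q \<subseteq> P \<and> gen Q}. Q \<subseteq> E \<longrightarrow> E = Q"
      by blast
    then show ?thesis by (intro that[of E]) simp_all
  qed
  define D where "D = A - P"
  have finED: "finite E" "finite D" "E \<inter> D = {}" using E(1) PA fin by (auto simp: D_def intro: finite_subset)
  \<comment> \<open>Equations on \<open>E\<close> are met exactly, constraints on \<open>D\<close>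
    with slack, those on \<open>B\<close> with strict slack. A member vanishing in all these
    coordinates would yield a feasible point. Affinity on \<open>E\<close> keeps the set
    convex.\<close>
  define C where "C = {c :: 'i + 'j \<Rightarrow> real. \<exists>w. (\<forall>i\<in>E. c (Inl i) = F i w) \<and>
      (\<forall>i\<in>D. c (Inl i) \<le> F i w) \<and> (\<forall>j\<in>B. c (Inr j) < G j w)}"
  have C_intro: "case_sum (\<lambda>i. F i w - (if i \<in> D then p i else 0)) (\<lambda>j. G j w - e j) \<in> C"
    if "\<forall>i\<in>D. 0 \<le> p i" "\<forall>j\<in>B. 0 < e j" for w p e
    unfolding C_def using that finED(3) by (auto intro!: exI[of _ w])
  have "\<exists>a. (\<exists>i\<in>(E \<union> D) <+> B. a i \<noteq> 0) \<and> (\<forall>c\<in>C. (\<Sum>i\<in>(E \<union> D) <+> B. a i * c i) \<le> 0)"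
  proof (rule separate_zero)
    show "finite ((E \<union> D) <+> B)" using finED fin by simp
    show "C \<noteq> {}" using C_intro[of "\<lambda>_. 0" "\<lambda>_. 1"] by auto
    show "(\<lambda>i. t * c i + (1 - t) * c' i) \<in> C" if "c \<in> C" "c' \<in> C" and t: "0 \<le> t" "t \<le> 1" for c c' t
    proof -
      obtain w where w: "\<forall>i\<in>E. c (Inl i) = F i w" "\<forall>i\<in>D. c (Inl i) \<le> F i w" "\<forall>j\<in>B. c (Inr j) < G j w"
        using \<open>c \<in> C\<close> by (auto simp: C_def)
      obtain w' where w': "\<forall>i\<in>E. c' (Inl i) = F i w'" "\<forall>i\<in>D. c' (Inl i) \<le> F i w'" "\<forall>j\<in>B. c' (Inr j) < G j w'"
        using \<open>c' \<in> C\<close> by (auto simp: C_def)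
      have "t * c (Inl i) + (1 - t) * c' (Inl i) = F i (m t w w')" if "i \<in> E" for i
        using affine[of i t w w'] w(1) w'(1) E(1) that t by auto
      moreover have "t * c (Inl i) + (1 - t) * c' (Inl i) \<le> F i (m t w w')" if "i \<in> D" for i
      proof -
        have "t * c (Inl i) + (1 - t) * c' (Inl i) \<le> t * F i w + (1 - t) * F i w'"
          using w(2) w'(2) that t by (intro add_mono mult_left_mono) auto
        also have "\<dots> \<le> F i (m t w w')" using concF that t by (auto simp: D_def)
        finally show ?thesis .
      qed
      moreover have "t * c (Inr j) + (1 - t) * c' (Inr j) < G j (m t w w')" if "j \<in> B" for j
      proof -
        have "t * c (Inr j) + (1 - t) * c' (Inr j) < t * G j w + (1 - t) * G j w'"
        \<comment> \<open>For \<open>t = 0\<close> the strict inequality comes from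
          \<open>w'\<close>, otherwise from \<open>w\<close>.\<close>
        proof (cases "t = 0")
          case False
          then show ?thesis
            using w(3) w'(3) that t by (intro add_less_le_mono mult_left_mono mult_strict_left_mono) auto
        qed (use w'(3) that in auto)
        also have "\<dots> \<le> G j (m t w w')" using concG that t by auto
        finally show ?thesis .
      qed
      ultimately show ?thesis unfolding C_def by (auto intro!: exI[of _ "m t w w'"])
    qed
    show "\<exists>i\<in>(E \<union> D) <+> B. c i \<noteq> 0" if "c \<in> C" for c
    proof (rule ccontr)
      assume contr: "\<not> (\<exists>i\<in>(E \<union> D) <+> B. c i \<noteq> 0)"
      have c0: "c (Inl i) = 0" if "i \<in> E \<union> D" for i
        using contr that by blast
      have c0': "c (Inr j) = 0" if "j \<in> B" for j
        using contr that by blast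
      obtain w where w: "\<forall>i\<in>E. c (Inl i) = F i w" "\<forall>i\<in>D. c (Inl i) \<le> F i w" "\<forall>j\<in>B. c (Inr j) < G j w"
        using \<open>c \<in> C\<close> by (auto simp: C_def)
      have "\<forall>i\<in>E. F i w = 0" using w(1) c0 by auto
      then have "\<forall>i\<in>P. F i w = 0" using E(2) unfolding gen_def by blast
      moreover have "\<forall>i\<in>D. 0 \<le> F i w" using w(2) c0 by auto
      moreover have "\<forall>j\<in>B. 0 < G j w" using w(3) c0' by auto
      ultimately show False using infeasible unfolding D_def by (metis DiffI order_refl)
    qed
  qed
  then obtain a where a: "\<exists>i\<in>(E \<union> D) <+> B. a i \<noteq> 0"
    and aC: "\<And>c. c \<in> C \<Longrightarrow> (\<Sum>i\<in>(E \<union> D) <+> B. a i * c i) \<le> 0" by blast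
  define l \<eta> where "l i = a (Inl i)" and "\<eta> j = a (Inr j)" for i j
  have sep: "(\<Sum>i\<in>E. l i * F i w) + (\<Sum>i\<in>D. l i * (F i w - p i)) + (\<Sum>j\<in>B. \<eta> j * (G j w - e j)) \<le> 0"
    if "\<forall>i\<in>D. 0 \<le> p i" "\<forall>j\<in>B. 0 < e j" for w p e
  proof -
    have "(\<Sum>i\<in>E. l i * (F i w - (if i \<in> D then p i else 0))) = (\<Sum>i\<in>E. l i * F i w)"
      using finED(3) by (intro sum.cong) auto
    moreover have "(\<Sum>i\<in>D. l i * (F i w - (if i \<in> D then p i else 0))) = (\<Sum>i\<in>D. l i * (F i w - p i))"
      by (intro sum.cong) auto
    ultimately show ?thesis
      using aC[OF C_intro[OF that, of w]] finED fin
      by (simp add: sum.Plus sum.union_disjoint l_def \<eta>_def comp_def del: if_distrib)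
  qed

  \<comment> \<open>Signs of the separating weights\<close>
  have nonneg_of_bound: "0 \<le> x" if "\<And>M. 0 \<le> M \<Longrightarrow> K - x * M \<le> 0" for x K :: real
  proof (rule ccontr)
    assume "\<not> 0 \<le> x"
    then have "K - x * ((\<bar>K\<bar> + 1) / - x) \<le> 0"
      by (intro that divide_nonneg_pos) auto
    with \<open>\<not> 0 \<le> x\<close> show False by simp
  qed
  \<comment> \<open>At one fixed point, for which \<open>undefined\<close> serves, the slack of
    constraint \<open>k\<close> grows without limit; the sum stays bounded above only if
    \<open>l k\<close> is nonnegative.\<close>
  have D_nonneg: "0 \<le> l k" if "k \<in> D" for k
  proof (rule nonneg_of_bound)
    fix M :: real assume "0 \<le> M"
    have "(\<Sum>i\<in>D. l i * (F i undefined - (if i = k then M else 0))) = (\<Sum>i\<in>D. l i * F i undefined) - l k * M"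
      using that finED(2) by (simp add: right_diff_distrib sum_subtractf if_distrib[of "(*) _"] cong: if_cong)
    moreover have "(\<Sum>i\<in>E. l i * F i undefined) +
        (\<Sum>i\<in>D. l i * (F i undefined - (if i = k then M else 0))) +
        (\<Sum>j\<in>B. \<eta> j * (G j undefined - 1)) \<le> 0"
      by (rule sep) (use \<open>0 \<le> M\<close> in auto)
    ultimately show "(\<Sum>i\<in>E. l i * F i undefined) + (\<Sum>i\<in>D. l i * F i undefined) +
        (\<Sum>j\<in>B. \<eta> j * (G j undefined - 1)) - l k * M \<le> 0"
      by linarith
  qed
  have \<eta>_nonneg: "0 \<le> \<eta> k" if "k \<in> B" for k
  proof (rule nonneg_of_bound)
    fix M :: real assume "0 \<le> M"
    \<comment> \<open>Slacks on \<open>B\<close> must be positive, hence the base value 1.\<close>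
    have "(\<Sum>j\<in>B. \<eta> j * (G j undefined - (1 + (if j = k then M else 0)))) =
        (\<Sum>j\<in>B. \<eta> j * (G j undefined - 1)) - \<eta> k * M"
      using that fin(2)
      by (simp add: right_diff_distrib distrib_left sum_subtractf sum.distrib if_distrib[of "(*) _"] cong: if_cong)
    moreover have "(\<Sum>i\<in>E. l i * F i undefined) + (\<Sum>i\<in>D. l i * (F i undefined - 0)) +
        (\<Sum>j\<in>B. \<eta> j * (G j undefined - (1 + (if j = k then M else 0)))) \<le> 0"
      by (rule sep) (use \<open>0 \<le> M\<close> in auto)
    ultimately show "(\<Sum>i\<in>E. l i * F i undefined) + (\<Sum>i\<in>D. l i * F i undefined) +
        (\<Sum>j\<in>B. \<eta> j * (G j undefined - 1)) - \<eta> k * M \<le> 0"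
      by simp
  qed
  have le: "(\<Sum>i\<in>E. l i * F i w) + (\<Sum>i\<in>D. l i * F i w) + (\<Sum>j\<in>B. \<eta> j * G j w) \<le> 0" (is "?T \<le> 0") for w
  proof (rule ccontr)
    define S where "S = (\<Sum>j\<in>B. \<eta> j)"
    assume T: "\<not> ?T \<le> 0"
    have eps: "?T \<le> \<epsilon> * S" if "\<epsilon> > 0" for \<epsilon>
      using sep[of "\<lambda>_. 0" "\<lambda>_. \<epsilon>" w] that
      by (simp add: S_def right_diff_distrib sum_subtractf sum_distrib_left mult.commute)
    have "0 \<le> S" unfolding S_def by (rule sum_nonneg) (rule \<eta>_nonneg)
    have "S > 0" using eps[of 1] T \<open>0 \<le> S\<close> by auto
    \<comment> \<open>The strict slack tends to zero: this choice would bound the positive number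
      \<open>?T\<close> by its half.\<close>
    then show False using eps[of "?T / (2 * S)"] T by simp
  qed
  \<comment> \<open>The weights on \<open>E\<close> have no sign, but adding a multiple of the null combination \<open>\<rho>\<close> repairs that.\<close>
  obtain t where t: "\<And>i. i \<in> P \<Longrightarrow> 0 \<le> t * \<rho> i - \<bar>l i\<bar>" "0 \<le> t"
  proof
    show "0 \<le> (\<Sum>i\<in>P. \<bar>l i\<bar> / \<rho> i)"
      using \<rho>(2) by (intro sum_nonneg) (simp add: less_imp_le)
    fix i assume i: "i \<in> P"
    have "\<bar>l i\<bar> / \<rho> i \<le> (\<Sum>i\<in>P. \<bar>l i\<bar> / \<rho> i)"
      using \<rho>(2) PA(2) i by (intro member_le_sum) (auto simp: less_imp_le)
    then show "0 \<le> (\<Sum>i\<in>P. \<bar>l i\<bar> / \<rho> i) * \<rho> i - \<bar>l i\<bar>"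
      using \<rho>(2)[OF i] by (simp add: field_simps)
  qed
  define \<delta> where "\<delta> i = (if i \<in> E \<union> D then l i else 0) + t * \<rho> i" for i
  have \<delta>_nonneg: "0 \<le> \<delta> i" if "i \<in> A" for i
  proof (cases "i \<in> P")
    case True
    then show ?thesis using t(1)[OF True] t(2) \<rho>0(1)[OF that] by (auto simp: \<delta>_def)
  next
    case False
    then show ?thesis using D_nonneg[of i] t(2) \<rho>0(1)[OF that] that by (auto simp: \<delta>_def D_def)
  qed
  have \<delta>_sum: "(\<Sum>i\<in>A. \<delta> i * F i w) = (\<Sum>i\<in>E. l i * F i w) + (\<Sum>i\<in>D. l i * F i w)" for w
  proof -
    have "(\<Sum>i\<in>A. \<delta> i * F i w) = (\<Sum>i\<in>A. (if i \<in> E \<union> D then l i * F i w else 0)) + t * (\<Sum>i\<in>A. \<rho> i * F i w)"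
      unfolding sum_distrib_left sum.distrib[symmetric]
      by (intro sum.cong refl) (simp add: \<delta>_def algebra_simps)
    also have "t * (\<Sum>i\<in>A. \<rho> i * F i w) = 0" using \<rho>(1) by (simp add: null_def)
    also have "(\<Sum>i\<in>A. (if i \<in> E \<union> D then l i * F i w else 0)) = (\<Sum>i\<in>E \<union> D. l i * F i w)"
      by (rule sum.mono_neutral_cong_right) (use fin E(1) PA in \<open>auto simp: D_def\<close>)
    finally show ?thesis using finED by (simp add: sum.union_disjoint)
  qed
  define S where "S = (\<Sum>j\<in>B. \<eta> j)"
  \<comment> \<open>Otherwise \<open>le\<close> and \<open>nonneg_comb\<close> make
    \<open>\<delta>\<close> null. As \<open>D\<close> avoids \<open>P\<close>, the weights on
    \<open>D\<close> vanish, so nontriviality leaves some \<open>k\<close> in \<open>E\<close> with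
    \<open>l k\<close> nonzero. The other equations of \<open>E\<close> then imply
    \<open>F k w = 0\<close>, against minimality.\<close>
  have "S > 0"
  proof (rule ccontr)
    assume "\<not> S > 0"
    moreover have "S \<ge> 0" unfolding S_def by (rule sum_nonneg) (rule \<eta>_nonneg)
    ultimately have \<eta>0: "\<eta> j = 0" if "j \<in> B" for j
      using sum_nonneg_eq_0_iff[of B \<eta>] fin(2) \<eta>_nonneg that by (auto simp: S_def)
    then have "\<forall>w. (\<Sum>i\<in>A. \<delta> i * F i w) \<le> 0" using le by (simp add: \<delta>_sum)
    then have null: "null \<delta>" using nonneg_comb[of \<delta>] \<delta>_nonneg by (auto simp: null_def)
    have D0: "l i = 0" if "i \<in> D" for i
    proof (rule ccontr)
      assume "l i \<noteq> 0"
      then have "\<delta> i > 0" using D_nonneg[OF that] that t(2) \<rho>0(1)[of i]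
        by (auto simp: \<delta>_def D_def intro!: add_pos_nonneg)
      then show False using null that by (auto simp: D_def P_def)
    qed
    then obtain k where k: "k \<in> E" "l k \<noteq> 0" using a \<eta>0 by (auto simp: l_def \<eta>_def)
    have "gen (E - {k})"
      unfolding gen_def
    proof (intro allI impI)
      fix w assume w: "\<forall>i\<in>E - {k}. F i w = 0"
      have "(\<Sum>i\<in>E. l i * F i w) = 0"
        using null \<delta>_sum[of w] D0 by (simp add: null_def)
      moreover have "(\<Sum>i\<in>E. l i * F i w) = l k * F k w"
        using w finED(1) k(1) by (simp add: sum.remove[of E k])
      ultimately have "F k w = 0" using k by simp
      then have "\<forall>i\<in>E. F i w = 0" using w by auto
      then show "\<forall>i\<in>P. F i w = 0" using E(2) unfolding gen_def by blast
    qed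
    then show False using E_min[of "E - {k}"] E(1) k by blast
  qed
  show thesis
  proof
    show "\<forall>i\<in>A. 0 \<le> \<delta> i / S" using \<delta>_nonneg \<open>S > 0\<close> by simp
    show "\<forall>j\<in>B. 0 \<le> \<eta> j / S" using \<eta>_nonneg \<open>S > 0\<close> by simp
    show "(\<Sum>j\<in>B. \<eta> j / S) = 1" using \<open>S > 0\<close> by (simp add: S_def flip: sum_divide_distrib)
    show "(\<Sum>i\<in>A. \<delta> i / S * F i w) + (\<Sum>j\<in>B. \<eta> j / S * G j w) \<le> 0" for w
    proof -
      have "(\<Sum>i\<in>A. \<delta> i / S * F i w) + (\<Sum>j\<in>B. \<eta> j / S * G j w) =
          ((\<Sum>i\<in>A. \<delta> i * F i w) + (\<Sum>j\<in>B. \<eta> j * G j w)) / S"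
        by (simp add: sum_divide_distrib add_divide_distrib)
      also have "\<dots> \<le> 0"
        using le[of w] \<open>S > 0\<close> by (simp add: \<delta>_sum divide_nonpos_pos)
      finally show ?thesis .
    qed
  qed
qed

section \<open>Certificates and interpolants\<close>

lemma sat_system:
  "sat w (system f g a b c e) \<longleftrightarrow>
    (\<forall>i\<in>{a..b}. 0 \<le> eval_mpoly w (f i)) \<and> (\<forall>j\<in>{c..e}. 0 < eval_mpoly w (g j))"
  by (simp add: system_def ball_Un atLeastLessThanSuc_atLeastAtMost del: upt_Suc)

lemma sum_split:
  fixes p :: "nat \<Rightarrow> 'a::comm_monoid_add"
  assumes "m \<le> n"
  shows "(\<Sum>i=1..n. p i) = (\<Sum>i=1..m. p i) + (\<Sum>i=m+1..n. p i)"
proof -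
  have "{1..n} = {1..m} \<union> {m+1..n}" using assms by auto
  then show ?thesis by (simp add: sum.union_disjoint)
qed

theorem theorem4:
  fixes d u v r1 r s1 s :: nat
    and f g :: "nat \<Rightarrow> mpoly"
    and \<phi> \<psi> :: formula
  assumes "r1 \<le> r" and "s1 \<le> s"
    and "\<And>i. i \<in> {1..r1} \<Longrightarrow>
           f i \<in> polys (xs d \<union> ys u) \<and> concave_quadratic (xs d \<union> ys u) (f i)"
    and "\<And>j. j \<in> {1..s1} \<Longrightarrow>
           g j \<in> polys (xs d \<union> ys u) \<and> concave_quadratic (xs d \<union> ys u) (g j)"
    and "\<And>i. i \<in> {r1+1..r} \<Longrightarrow>
           f i \<in> polys (xs d \<union> zs v) \<and> concave_quadratic (xs d \<union> zs v) (f i)"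
    and "\<And>j. j \<in> {s1+1..s} \<Longrightarrow>
           g j \<in> polys (xs d \<union> zs v) \<and> concave_quadratic (xs d \<union> zs v) (g j)"
    and "\<phi> = system f g 1 r1 1 s1"
    and "\<psi> = system f g (r1+1) r (s1+1) s"
    and "unsat (Conj [\<phi>, \<psi>])"
    and "\<nexists>\<delta> :: nat \<Rightarrow> real. (\<forall>i\<in>{1..r}. \<delta> i \<ge> 0) \<and>
           sos (- (\<Sum>i=1..r. Const (\<delta> i) * f i)) \<and>
           - (\<Sum>i=1..r. Const (\<delta> i) * f i) \<noteq> 0"
  shows "(\<exists>l \<eta> h1 h2. certificate d u v r s f g l \<eta> h1 h2) \<and>
    (\<forall>l \<eta> h1 h2. certificate d u v r s f g l \<eta> h1 h2 \<longrightarrow>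
      (let I = (\<Sum>i=1..r1. Const (l i) * f i) + (\<Sum>j=1..s1. Const (\<eta> j) * g j)
                 + Const (\<eta> 0) + h1
       in I \<in> polys (xs d) \<and>
          (if (\<Sum>j=0..s1. \<eta> j) > 0
           then interpolant (xs d) \<phi> \<psi> (Gt0 I)
           else interpolant (xs d) \<phi> \<psi> (Ge0 I))))"
proof -
  note r = assms(1) and s = assms(2) and \<phi> = assms(7) and \<psi> = assms(8)
  note poly_conc = assms(3-6)
  define V1 V2 where "V1 = xs d \<union> ys u" and "V2 = xs d \<union> zs v"
  have f1: "f i \<in> polys V1" "concave_quadratic V1 (f i)" if "i \<in> {1..r1}" for i
    using poly_conc(1)[OF that] by (simp_all add: V1_def)
  have g1: "g j \<in> polys V1" "concave_quadratic V1 (g j)" if "j \<in> {1..s1}" for j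
    using poly_conc(2)[OF that] by (simp_all add: V1_def)
  have f2: "f i \<in> polys V2" "concave_quadratic V2 (f i)" if "i \<in> {r1+1..r}" for i
    using poly_conc(3)[OF that] by (simp_all add: V2_def)
  have g2: "g j \<in> polys V2" "concave_quadratic V2 (g j)" if "j \<in> {s1+1..s}" for j
    using poly_conc(4)[OF that] by (simp_all add: V2_def)
  \<comment> \<open>Used twice: with zero \<open>\<eta>\<close>, to show that a nonpositive
    combination of the \<open>f i\<close> is minus a sum of squares, and with the multipliers of the
    alternative, to build the certificate.\<close>
  have split: "\<exists>h1 h2. sos h1 \<and> h1 \<in> polys V1 \<and> total_degree h1 \<le> 2 \<and>
      sos h2 \<and> h2 \<in> polys V2 \<and> total_degree h2 \<le> 2 \<and>
      (\<Sum>i=1..r. Const (l i) * f i) + (\<Sum>j=1..s. Const (\<eta> j) * g j) + Const (\<eta> 0) + h1 + h2 = 0"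
    if nonneg: "\<forall>i\<in>{1..r}. 0 \<le> l i" "\<forall>j\<in>{0..s}. 0 \<le> \<eta> j"
      and le: "\<And>w. (\<Sum>i=1..r. l i * eval_mpoly w (f i)) + (\<Sum>j=1..s. \<eta> j * eval_mpoly w (g j)) + \<eta> 0 \<le> 0"
    for l \<eta> :: "nat \<Rightarrow> real"
  proof -
    define p where "p = (\<Sum>i=1..r1. Const (l i) * f i) + (\<Sum>j=1..s1. Const (\<eta> j) * g j) + Const (\<eta> 0)"
    define q where "q = (\<Sum>i=r1+1..r. Const (l i) * f i) + (\<Sum>j=s1+1..s. Const (\<eta> j) * g j)"
    have pq: "p + q = (\<Sum>i=1..r. Const (l i) * f i) + (\<Sum>j=1..s. Const (\<eta> j) * g j) + Const (\<eta> 0)"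
      unfolding p_def q_def sum_split[OF r] sum_split[OF s] by (simp add: algebra_simps)
    have p: "concave_quadratic V1 p" unfolding p_def
      by (intro concave_quadratic_add concave_quadratic_sum concave_quadratic_Const
          concave_quadratic_Const_mult f1 g1) (use nonneg r s in auto)
    have q: "concave_quadratic V2 q" unfolding q_def
      by (intro concave_quadratic_add concave_quadratic_sum concave_quadratic_Const_mult f2 g2)
        (use nonneg in auto)
    have pq_le: "eval_mpoly w p + eval_mpoly w q \<le> 0" for w
      unfolding eval_mpoly_add[symmetric] pq using le[of w] by simp
    have blocks: "finite (xs d)" "finite (ys u)" "finite (zs v)"
      "xs d \<inter> ys u = {}" "xs d \<inter> zs v = {}" "ys u \<inter> zs v = {}"
      by (auto simp: xs_def ys_def zs_def)
    obtain h1 h2 where "sos h1" "h1 \<in> polys V1" "total_degree h1 \<le> 2"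
        "sos h2" "h2 \<in> polys V2" "total_degree h2 \<le> 2" "p + q + h1 + h2 = 0"
      using split_nonpositive_concave_quadratic[OF blocks p[unfolded V1_def] q[unfolded V2_def] pq_le]
      unfolding V1_def V2_def .
    then show ?thesis unfolding pq by blast
  qed
  show ?thesis
  proof (intro conjI allI impI)

    \<comment> \<open>Existence of a certificate\<close>
    define G where "G j w = (if j = 0 then 1 else eval_mpoly w (g j))" for j :: nat and w
    have f_concave: "t * eval_mpoly w (f i) + (1 - t) * eval_mpoly w' (f i) \<le> eval_mpoly (mix t w w') (f i)"
      if "i \<in> {1..r}" "0 \<le> t" "t \<le> 1" for i t w w'
      using f1(2)[of i] f2(2)[of i] that by (cases "i \<le> r1") (auto intro: concave_quadratic_concave)
    \<comment> \<open>Index 0 of \<open>G\<close> is the constraint \<open>1 > 0\<close>; its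
      multiplier becomes the constant term \<open>\<eta> 0\<close> and counts in the
      normalisation.\<close>
    have G_concave: "t * G j w + (1 - t) * G j w' \<le> G j (mix t w w')"
      if "j \<in> {0..s}" "0 \<le> t" "t \<le> 1" for j t w w'
      using g1(2)[of j] g2(2)[of j] that
      by (cases "j = 0"; cases "j \<le> s1") (auto simp: G_def intro: concave_quadratic_concave)
    \<comment> \<open>The hypothesis on sums of squares enters here: \<open>split\<close> makes
      \<open>- ?F\<close> a sum of squares, so it must be zero.\<close>
    have nsc: "\<forall>w. (\<Sum>i=1..r. \<delta> i * eval_mpoly w (f i)) = 0"
      if \<delta>: "\<forall>i\<in>{1..r}. 0 \<le> \<delta> i" "\<forall>w. (\<Sum>i=1..r. \<delta> i * eval_mpoly w (f i)) \<le> 0" for \<delta>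
    proof -
      let ?F = "\<Sum>i=1..r. Const (\<delta> i) * f i"
      obtain h1 h2 where "sos h1" "sos h2" "?F + h1 + h2 = 0"
        using split[of \<delta> "\<lambda>_. 0"] \<delta> by auto
      moreover from this have "- ?F = h1 + h2"
        by (intro minus_unique) (simp add: add.assoc)
      ultimately have "sos (- ?F)" by (simp add: sos_add)
      then have "?F = 0" using assms(10) \<delta>(1) by auto
      then have "eval_mpoly w ?F = 0" for w by simp
      then show ?thesis by simp
    qed
    have infeasible: "\<nexists>w. (\<forall>i\<in>{1..r}. 0 \<le> eval_mpoly w (f i)) \<and> (\<forall>j\<in>{0..s}. 0 < G j w)"
    proof
      assume "\<exists>w. (\<forall>i\<in>{1..r}. 0 \<le> eval_mpoly w (f i)) \<and> (\<forall>j\<in>{0..s}. 0 < G j w)"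
      then obtain w where w: "\<forall>i\<in>{1..r}. 0 \<le> eval_mpoly w (f i)" "\<forall>j\<in>{0..s}. 0 < G j w" by blast
      have "0 < eval_mpoly w (g j)" if "j \<in> {1..s}" for j
        using w(2)[rule_format, of j] that by (simp add: G_def)
      then have "sat w (Conj [\<phi>, \<psi>])"
        using w(1) r s by (simp add: \<phi> \<psi> sat_system)
      then show False using assms(9) unfolding unsat_def by blast
    qed
    obtain l \<eta> where cert: "\<forall>i\<in>{1..r}. 0 \<le> l i" "\<forall>j\<in>{0..s}. 0 \<le> \<eta> j" "(\<Sum>j=0..s. \<eta> j) = 1"
      and le: "\<And>w. (\<Sum>i=1..r. l i * eval_mpoly w (f i)) + (\<Sum>j=0..s. \<eta> j * G j w) \<le> 0"
      by (rule concave_alternative[OF _ _ f_concave G_concave nsc infeasible]) auto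
    have "(\<Sum>j=0..s. \<eta> j * G j w) = (\<Sum>j=1..s. \<eta> j * eval_mpoly w (g j)) + \<eta> 0" for w
      by (simp add: sum.atLeast_Suc_atMost[of 0 s] G_def)
    then have "(\<Sum>i=1..r. l i * eval_mpoly w (f i)) + (\<Sum>j=1..s. \<eta> j * eval_mpoly w (g j)) + \<eta> 0 \<le> 0" for w
      using le[of w] by simp
    then show "\<exists>l \<eta> h1 h2. certificate d u v r s f g l \<eta> h1 h2"
      using split[OF cert(1,2)] cert unfolding certificate_def V1_def V2_def by blast
  next

    \<comment> \<open>From a certificate to an interpolant\<close>
    fix l \<eta> h1 h2 assume "certificate d u v r s f g l \<eta> h1 h2"
    then have l: "\<And>i. i \<in> {1..r} \<Longrightarrow> 0 \<le> l i" and \<eta>: "\<And>j. j \<in> {0..s} \<Longrightarrow> 0 \<le> \<eta> j"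
      and h: "sos h1" "h1 \<in> polys V1" "sos h2" "h2 \<in> polys V2"
      and zero: "(\<Sum>i=1..r. Const (l i) * f i) + (\<Sum>j=1..s. Const (\<eta> j) * g j) + Const (\<eta> 0) + h1 + h2 = 0"
      and one: "(\<Sum>j=0..s. \<eta> j) = 1"
      by (simp_all add: certificate_def V1_def V2_def)
    define I where "I = (\<Sum>i=1..r1. Const (l i) * f i) + (\<Sum>j=1..s1. Const (\<eta> j) * g j) + Const (\<eta> 0) + h1"
    \<comment> \<open>The certificate reads \<open>I + J = 0\<close>. Hence \<open>I\<close> has
      only variables of \<open>V1\<close> by its own form and only variables of \<open>V2\<close> as
      \<open>- J\<close>, which leaves the shared block.\<close>
    define J where "J = (\<Sum>i=r1+1..r. Const (l i) * f i) + (\<Sum>j=s1+1..s. Const (\<eta> j) * g j) + h2"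
    have "I + J = 0"
      using zero unfolding I_def J_def sum_split[OF r] sum_split[OF s] by (simp add: algebra_simps)
    then have IJ: "I = - J" by (simp add: eq_neg_iff_add_eq_0)
    have "I \<in> polys V1" unfolding I_def
      by (intro polys_add polys_sum polys_mult polys_Const f1 g1 h)
    moreover have "I \<in> polys V2" unfolding IJ J_def
      by (intro polys_uminus polys_add polys_sum polys_mult polys_Const f2 g2 h)
    moreover have "V1 \<inter> V2 = xs d" by (auto simp: V1_def V2_def xs_def ys_def zs_def)
    ultimately have I_polys: "I \<in> polys (xs d)" using polys_Int by metis
    have \<eta>0: "0 \<le> \<eta> 0" using \<eta> by simp
    have sat_\<phi>: "(\<forall>i\<in>{1..r1}. 0 \<le> eval_mpoly w (f i)) \<and> (\<forall>j\<in>{1..s1}. 0 < eval_mpoly w (g j))"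
      if "sat w \<phi>" for w using that by (simp add: \<phi> sat_system)
    have sat_\<psi>: "(\<forall>i\<in>{r1+1..r}. 0 \<le> eval_mpoly w (f i)) \<and> (\<forall>j\<in>{s1+1..s}. 0 < eval_mpoly w (g j))"
      if "sat w \<psi>" for w using that by (simp add: \<psi> sat_system)
    have I_ge: "(\<Sum>j=1..s1. \<eta> j * eval_mpoly w (g j)) + \<eta> 0 \<le> eval_mpoly w I" if "sat w \<phi>" for w
    proof -
      have "0 \<le> (\<Sum>i=1..r1. l i * eval_mpoly w (f i))"
        by (intro sum_nonneg mult_nonneg_nonneg) (use l r sat_\<phi>[OF that] in auto)
      then show ?thesis using eval_mpoly_sos[OF h(1), of w] by (simp add: I_def)
    qed
    have J_ge: "(\<Sum>j=s1+1..s. \<eta> j * eval_mpoly w (g j)) \<le> - eval_mpoly w I" if "sat w \<psi>" for w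
    proof -
      have "0 \<le> (\<Sum>i=r1+1..r. l i * eval_mpoly w (f i))"
        by (intro sum_nonneg mult_nonneg_nonneg) (use l sat_\<psi>[OF that] in auto)
      then show ?thesis using eval_mpoly_sos[OF h(3), of w] by (simp add: IJ J_def)
    qed
    have g_nonneg1: "0 \<le> \<eta> j * eval_mpoly w (g j)" if "sat w \<phi>" "j \<in> {1..s1}" for w j
      using \<eta>[of j] sat_\<phi>[OF that(1)] that(2) s by (intro mult_nonneg_nonneg) (auto simp: less_imp_le)
    have g_nonneg2: "0 \<le> \<eta> j * eval_mpoly w (g j)" if "sat w \<psi>" "j \<in> {s1+1..s}" for w j
      using \<eta>[of j] sat_\<psi>[OF that(1)] that(2) by (intro mult_nonneg_nonneg) (auto simp: less_imp_le)
    have "if (\<Sum>j=0..s1. \<eta> j) > 0 then interpolant (xs d) \<phi> \<psi> (Gt0 I) else interpolant (xs d) \<phi> \<psi> (Ge0 I)"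
    proof (cases "(\<Sum>j=0..s1. \<eta> j) > 0")
      case True
      then obtain k where k: "k \<in> {0..s1}" "\<eta> k > 0"
        by (meson not_le sum_nonpos)
      have "0 < eval_mpoly w I" if w: "sat w \<phi>" for w
      proof -
        have "0 < (\<Sum>j=1..s1. \<eta> j * eval_mpoly w (g j)) + \<eta> 0"
        \<comment> \<open>The positive multiplier may be that of the constant, which belongs to no
          \<open>g j\<close>.\<close>
        proof (cases "k = 0")
          case True
          then have "0 < \<eta> 0" using k(2) by simp
          moreover have "0 \<le> (\<Sum>j=1..s1. \<eta> j * eval_mpoly w (g j))"
            by (intro sum_nonneg g_nonneg1[OF w])
          ultimately show ?thesis by linarith
        next
          case False
          then have "0 < (\<Sum>j=1..s1. \<eta> j * eval_mpoly w (g j))"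
            using k sat_\<phi>[OF w] by (intro sum_pos2[of _ k] g_nonneg1[OF w]) auto
          then show ?thesis using \<eta>0 by linarith
        qed
        then show ?thesis using I_ge[OF w] by linarith
      qed
      moreover have "eval_mpoly w I \<le> 0" if w: "sat w \<psi>" for w
      proof -
        have "0 \<le> (\<Sum>j=s1+1..s. \<eta> j * eval_mpoly w (g j))"
          by (intro sum_nonneg g_nonneg2[OF w])
        then show ?thesis using J_ge[OF w] by linarith
      qed
      ultimately show ?thesis
        using True I_polys by (force simp: interpolant_def entails_def unsat_def polys_def)
    next
      case False
      \<comment> \<open>With no weight on the side of \<open>\<phi>\<close>, the normalisation puts
        positive weight on a strict constraint of \<open>\<psi>\<close>. So \<open>I\<close> is
        negative on \<open>\<psi>\<close>, and the weak inequality suffices on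
        \<open>\<phi>\<close>.\<close>
      have "(\<Sum>j=0..s. \<eta> j) = (\<Sum>j=0..s1. \<eta> j) + (\<Sum>j=s1+1..s. \<eta> j)"
        using s by (simp add: sum.atLeast_Suc_atMost[of 0 _ \<eta>] sum_split[OF s, of \<eta>, simplified])
      then have "(\<Sum>j=s1+1..s. \<eta> j) > 0" using one False by linarith
      then obtain k where k: "k \<in> {s1+1..s}" "\<eta> k > 0"
        by (meson not_le sum_nonpos)
      have "eval_mpoly w I < 0" if w: "sat w \<psi>" for w
      proof -
        have "0 < (\<Sum>j=s1+1..s. \<eta> j * eval_mpoly w (g j))"
          using k sat_\<psi>[OF w] by (intro sum_pos2[of _ k] g_nonneg2[OF w]) auto
        then show ?thesis using J_ge[OF w] by linarith
      qed
      moreover have "0 \<le> eval_mpoly w I" if w: "sat w \<phi>" for w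
      proof -
        have "0 \<le> (\<Sum>j=1..s1. \<eta> j * eval_mpoly w (g j))"
          by (intro sum_nonneg g_nonneg1[OF w])
        then show ?thesis using I_ge[OF w] \<eta>0 by linarith
      qed
      ultimately show ?thesis
        using False I_polys by (force simp: interpolant_def entails_def unsat_def polys_def)
    qed
    then show "let I = (\<Sum>i=1..r1. Const (l i) * f i) + (\<Sum>j=1..s1. Const (\<eta> j) * g j) + Const (\<eta> 0) + h1
       in I \<in> polys (xs d) \<and>
          (if (\<Sum>j=0..s1. \<eta> j) > 0
           then interpolant (xs d) \<phi> \<psi> (Gt0 I)
           else interpolant (xs d) \<phi> \<psi> (Ge0 I))"
      using I_polys unfolding Let_def I_def[symmetric] by blast
  qed
qed

end
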